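(* Let $X$ and $Y$ be standard Borel spaces, let $Z$ be a measurable space, let $\mu$ be an s-finite kernel from $Z$ to $X$ and $\nu$ an s-finite kernel from $Z$ to $Y$, and let $\phi:X\to Y$ be a measurable function such that $\phi_*\mu\ll\nu$ and, for all $z\in Z$, $$\mu\big(z,\phi^{-1}(\infty[\nu(z)])\setminus\infty[\mu(z)]\big)=0.$$ Then there exists an s-finite kernel $k$ from $Z\times Y$ to $X$ that is a disintegration of $\mu$ with respect to $\phi$ and $\nu$. The kernel $k$ can be chosen to be a probability kernel if $\mu$ is $\sigma$-finite and $\phi_*\mu=\nu$. The existence statement may fail if the two conditions on $\phi,\mu,\nu$ are replaced by the condition $\phi_*\mu\stackrel{\infty}{\ll}\nu$ only: there exist standard Borel $X,Y$, a measurable space $Z$, s-finite kernels $\mu$ from $Z$ to $X$ and $\nu$ from $Z$ to $Y$, and a measurable $\phi:X\to Y$ with $\phi_*\mu\stackrel{\infty}{\ll}\nu$, for which there is no disintegration of $\mu$ with respect to $\phi$ and $\nu$.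
   Context: A kernel from a measurable space $X$ to a measurable space $Y$ is a map $k:X\times\Sigma_Y\to[0,\infty]$ that is measurable in its first argument and a measure in its second; $k(x)$ denotes the measure $k(x,-)$. It is a probability kernel if $k(x,Y)=1$ for all $x$; finite if $\sup_{x\in X}k(x,Y)<\infty$; s-finite if $k=\sum_{i\in\mathbb{N}}k_i$ with each $k_i$ a finite kernel from $X$ to $Y$; $\sigma$-finite if moreover the $k_i$ can be chosen pairwise mutually singular, where $k,l$ are mutually singular if there is $A\in\Sigma_{X\times Y}$ such that, writing $A^x=\{y\mid(x,y)\in A\}$, $k(x,Y\setminus A^x)=0=l(x,A^x)$ for all $x\in X$. The pushforward of a kernel $\mu$ from $Z$ to $X$ along $\phi:X\to Y$ is $(\phi_*\mu)(z,V)=\mu(z,\phi^{-1}(V))$. Disintegration: a kernel $k$ from $Z\times Y$ to $X$ is a disintegration of $\mu$ with respect to $\phi$ and $\nu$ if (a) for all $z\in Z$ and $U\in\Sigma_X$, $\int_Y\nu(z,\mathrm{d}y)\,k((z,y),U)=\mu(z,U)$; and (b) for all $z\in Z$, for $\nu(z)$-almost all $y$, $k((z,y),X\setminus\phi^{-1}(y))=0$. Given a measure $m$ on a space $W$, a set $U\in\Sigma_W$ is an $m$-$0$-$\infty$-set if every measurable $V\subseteq U$ satisfies $m(V)\in\{0,\infty\}$. A top $0$-$\infty$-set for $m$ is an $m$-$0$-$\infty$-set $A$ such that $m(B\setminus A)=0$ for every $m$-$0$-$\infty$-set $B$; every s-finite measure has one, it is unique up to $m$-null sets, and $\infty[m]$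 denotes a choice of it. For kernels $\kappa,\lambda$ with the same source and target: $\kappa\ll\lambda$ means that for every point $z$ of the source every $\lambda(z)$-null set is $\kappa(z)$-null; $\kappa\stackrel{\infty}{\ll}\lambda$ means that $\kappa\ll\lambda$ and, for every $z$, every $\lambda(z)$-$0$-$\infty$-set is a $\kappa(z)$-$0$-$\infty$-set. A standard Borel space is a nonempty set with the Borel $\sigma$-algebra of some complete separable metric; equivalently, a measurable retract of $\mathbb{R}$. *)

theory Defs
  imports "HOL-Analysis.Analysis"
begin

text \<open>A measurable space is represented by a value of type \<^typ>\<open>'a measure\<close> of which only
  \<^const>\<open>space\<close> and \<^const>\<open>sets\<close> are used. Kernels are functions that are only constrained
  on the carrier of their source.\<close>

definition standard_borel :: "'a measure \<Rightarrow> bool" where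
  "standard_borel M \<longleftrightarrow> space M \<noteq> {} \<and>
     (\<exists>d. Metric_space (space M) d \<and>
          Metric_space.mcomplete (space M) d \<and>
          separable_space (Metric_space.mtopology (space M) d) \<and>
          sets M = sigma_sets (space M) {U. openin (Metric_space.mtopology (space M) d) U})"

definition kernel :: "'a measure \<Rightarrow> 'b measure \<Rightarrow> ('a \<Rightarrow> 'b measure) \<Rightarrow> bool" where
  "kernel X Y k \<longleftrightarrow>
     (\<forall>x\<in>space X. sets (k x) = sets Y) \<and>
     (\<forall>V\<in>sets Y. (\<lambda>x. emeasure (k x) V) \<in> borel_measurable X)"

definition prob_kernel :: "'a measure \<Rightarrow> 'b measure \<Rightarrow> ('a \<Rightarrow> 'b measure) \<Rightarrow> bool" where
  "prob_kernel X Y k \<longleftrightarrow> kernel X Y k \<and> (\<forall>x\<in>space X. emeasure (k x) (space Y) = 1)"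

definition finite_kernel :: "'a measure \<Rightarrow> 'b measure \<Rightarrow> ('a \<Rightarrow> 'b measure) \<Rightarrow> bool" where
  "finite_kernel X Y k \<longleftrightarrow> kernel X Y k \<and> (SUP x\<in>space X. emeasure (k x) (space Y)) < \<infinity>"

definition kernel_sums ::
    "'a measure \<Rightarrow> 'b measure \<Rightarrow> (nat \<Rightarrow> 'a \<Rightarrow> 'b measure) \<Rightarrow> ('a \<Rightarrow> 'b measure) \<Rightarrow> bool" where
  "kernel_sums X Y ki k \<longleftrightarrow>
     (\<forall>x\<in>space X. \<forall>V\<in>sets Y. emeasure (k x) V = (\<Sum>i. emeasure (ki i x) V))"

definition s_finite_kernel :: "'a measure \<Rightarrow> 'b measure \<Rightarrow> ('a \<Rightarrow> 'b measure) \<Rightarrow> bool" where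
  "s_finite_kernel X Y k \<longleftrightarrow> kernel X Y k \<and>
     (\<exists>ki. (\<forall>i. finite_kernel X Y (ki i)) \<and> kernel_sums X Y ki k)"

definition mutually_singular_kernels ::
    "'a measure \<Rightarrow> 'b measure \<Rightarrow> ('a \<Rightarrow> 'b measure) \<Rightarrow> ('a \<Rightarrow> 'b measure) \<Rightarrow> bool" where
  "mutually_singular_kernels X Y k l \<longleftrightarrow>
     (\<exists>A\<in>sets (X \<Otimes>\<^sub>M Y). \<forall>x\<in>space X.
        emeasure (k x) (space Y - {y. (x, y) \<in> A}) = 0 \<and>
        emeasure (l x) {y. (x, y) \<in> A} = 0)"

definition sigma_finite_kernel :: "'a measure \<Rightarrow> 'b measure \<Rightarrow> ('a \<Rightarrow> 'b measure) \<Rightarrow> bool" where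
  "sigma_finite_kernel X Y k \<longleftrightarrow> kernel X Y k \<and>
     (\<exists>ki. (\<forall>i. finite_kernel X Y (ki i)) \<and> kernel_sums X Y ki k \<and>
           (\<forall>i j. i \<noteq> j \<longrightarrow> mutually_singular_kernels X Y (ki i) (ki j)))"

definition pushforward_kernel ::
    "'b measure \<Rightarrow> ('a \<Rightarrow> 'b) \<Rightarrow> ('c \<Rightarrow> 'a measure) \<Rightarrow> 'c \<Rightarrow> 'b measure" where
  "pushforward_kernel Y \<phi> \<mu> = (\<lambda>z. distr (\<mu> z) Y \<phi>)"

text \<open>The fibre in the second clause is measurable whenever points of \<open>Y\<close> are, in particular
  when \<open>Y\<close> is standard Borel.\<close>

definition disintegration ::
    "'c measure \<Rightarrow> 'a measure \<Rightarrow> 'b measure \<Rightarrow> ('c \<Rightarrow> 'a measure) \<Rightarrow> ('a \<Rightarrow> 'b) \<Rightarrow>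
     ('c \<Rightarrow> 'b measure) \<Rightarrow> ('c \<times> 'b \<Rightarrow> 'a measure) \<Rightarrow> bool" where
  "disintegration Z X Y \<mu> \<phi> \<nu> k \<longleftrightarrow> kernel (Z \<Otimes>\<^sub>M Y) X k \<and>
     (\<forall>z\<in>space Z. \<forall>U\<in>sets X. (\<integral>\<^sup>+ y. emeasure (k (z, y)) U \<partial>\<nu> z) = emeasure (\<mu> z) U) \<and>
     (\<forall>z\<in>space Z. AE y in \<nu> z. emeasure (k (z, y)) (space X - \<phi> -` {y}) = 0)"

definition zero_infty_set :: "'a measure \<Rightarrow> 'a set \<Rightarrow> bool" where
  "zero_infty_set m U \<longleftrightarrow> U \<in> sets m \<and>
     (\<forall>V\<in>sets m. V \<subseteq> U \<longrightarrow> emeasure m V \<in> {0, \<infinity>})"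

definition is_top_zero_infty_set :: "'a measure \<Rightarrow> 'a set \<Rightarrow> bool" where
  "is_top_zero_infty_set m A \<longleftrightarrow> zero_infty_set m A \<and>
     (\<forall>B. zero_infty_set m B \<longrightarrow> emeasure m (B - A) = 0)"

definition top_zero_infty_set :: "'a measure \<Rightarrow> 'a set" where
  "top_zero_infty_set m = (SOME A. is_top_zero_infty_set m A)"

text \<open>In both relations the dominated kernel comes first, whereas the library's
  \<^const>\<open>absolutely_continuous\<close> takes the dominating measure first.\<close>

definition abs_cont_kernel ::
    "'c measure \<Rightarrow> ('c \<Rightarrow> 'a measure) \<Rightarrow> ('c \<Rightarrow> 'a measure) \<Rightarrow> bool" where
  "abs_cont_kernel Z \<kappa> \<rho> \<longleftrightarrow> (\<forall>z\<in>space Z. absolutely_continuous (\<rho> z) (\<kappa> z))"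

definition infty_abs_cont_kernel ::
    "'c measure \<Rightarrow> ('c \<Rightarrow> 'a measure) \<Rightarrow> ('c \<Rightarrow> 'a measure) \<Rightarrow> bool" where
  "infty_abs_cont_kernel Z \<kappa> \<rho> \<longleftrightarrow> abs_cont_kernel Z \<kappa> \<rho> \<and>
     (\<forall>z\<in>space Z. \<forall>U. zero_infty_set (\<rho> z) U \<longrightarrow> zero_infty_set (\<kappa> z) U)"

end

(* All kernels reduce to bounded densities. If K <= R are kernels to the line, the ratios of K to R on
   dyadic cells are, for each parameter z, an L2-bounded martingale; a measurable choice of a fast
   subsequence makes it converge almost everywhere, which gives a jointly measurable derivative.
   For phi_* mu <= rho, apply this to the restrictions of mu to {e > c}, where e is a coordinate
   X -> (0, 1) and c is rational. The derivatives are tail functions, and the image of Lebesgue measure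
   on (0, 1) under the corresponding quantile function is the disintegration; it is jointly
   measurable by construction.

   In the s-finite case choose a finite rho equivalent to nu that dominates the pieces of
   phi_* mu, and write nu = h rho. The set {h = infinity} is the top 0-infinity set of nu, and by the
   hypothesis mu has only the values 0 and infinity above it. Dividing the disintegration with
   respect to rho by h where h is finite therefore gives one with respect to nu. If mu is
   sigma-finite and phi_* mu = nu, then mu has no non-null 0-infinity sets, so nu is sigma-finite and
   the fibre masses are almost everywhere 1. *)
theory Submission
  imports Defs "HOL-Probability.Giry_Monad"
begin

section \<open>Jointly measurable Radon--Nikodym derivatives on the line\<close>

text \<open>The obstacle is joint measurability. A derivative chosen for each \<open>z\<close>
  separately is fixed only up to a null set depending on \<open>z\<close>, and uncountably many such
  choices need not fit together. So every object must be given by a formula in countably many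
  quantities measurable in \<open>z\<close>, including the indices of the subsequence. Working in L2
  serves this end: the squared distance between two levels is the difference of two numbers, so the
  speed of convergence can be read off from numbers depending on \<open>z\<close>. The same concern
  leads to quantile functions. The tail functions decrease in the level only almost everywhere; a
  supremum over countably many levels makes sense at every point, and the almost-everywhere facts
  enter only under an integral. Where the density of \<open>\<nu>\<close> is infinite no rescaling
  can produce a prescribed finite positive mass. This is why a condition on 0-infinity sets is
  present, and it is also the mechanism of the counterexample.\<close>

definition dyadic_cell :: "nat \<Rightarrow> real \<Rightarrow> int" where
  "dyadic_cell n y = \<lfloor>2 ^ n * y\<rfloor>"

lemma measurable_dyadic_cell [measurable]: "dyadic_cell n \<in> borel \<rightarrow>\<^sub>M count_space UNIV"
  unfolding dyadic_cell_def by measurable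

lemma sets_dyadic_cell_vimage [measurable]: "dyadic_cell n -` A \<in> sets borel"
  using measurable_sets[OF measurable_dyadic_cell, of A n] by simp

text \<open>Nestedness of the partitions in arithmetic form: any function of the cell at level
  \<open>m\<close> is a function of the cell at a finer level \<open>n\<close>, obtained by integer
  division.\<close>

lemma dyadic_cell_div:
  assumes "m \<le> n"
  shows "dyadic_cell m y = dyadic_cell n y div 2 ^ (n - m)"
proof -
  have "2 ^ n * y / of_int (2 ^ (n - m)) = 2 ^ m * y"
    using assms by (simp add: field_simps flip: power_add)
  then show ?thesis
    unfolding dyadic_cell_def using floor_divide_real_eq_div[of "2 ^ (n - m)" "2 ^ n * y"] by simp
qed

text \<open>Together with \<open>dyadic_cell_less_mono\<close> this writes a half-line
  \<open>{x<..}\<close> as an increasing union of preimages under \<open>dyadic_cell n\<close>.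
  Hence a finite measure on the line is determined by its values on cells.\<close>

lemma less_iff_dyadic_cell_less: "x < y \<longleftrightarrow> (\<exists>n. dyadic_cell n x < dyadic_cell n y)"
proof
  assume "x < y"
  then obtain n where n: "inverse (2 ^ n) < y - x"
    using reals_power_lt_ex[of "y - x" 2] by (auto simp: power_one_over inverse_eq_divide)
  then have "2 ^ n * inverse (2 ^ n) < 2 ^ n * (y - x)"
    by (intro mult_strict_left_mono) auto
  then have "2 ^ n * x + 1 < 2 ^ n * y"
    by (simp add: algebra_simps)
  then have "dyadic_cell n x < dyadic_cell n y"
    unfolding dyadic_cell_def by linarith
  then show "\<exists>n. dyadic_cell n x < dyadic_cell n y" ..
next
  assume "\<exists>n. dyadic_cell n x < dyadic_cell n y"
  then show "x < y"
    unfolding dyadic_cell_def by (metis floor_mono linorder_not_le mult_left_mono zero_le_numeral zero_le_power)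
qed

lemma dyadic_cell_less_mono:
  assumes "dyadic_cell m x < dyadic_cell m y" "m \<le> n"
  shows "dyadic_cell n x < dyadic_cell n y"
  using assms dyadic_cell_div[OF \<open>m \<le> n\<close>, of x] dyadic_cell_div[OF \<open>m \<le> n\<close>, of y]
  by (metis linorder_not_le zdiv_mono1 zero_less_numeral zero_less_power)

text \<open>A cell without \<open>R\<close>-mass gets ratio 0 by the convention for division. Under
  domination \<open>K\<close> does not charge such a cell either, so the ratio is still a density on
  cells.\<close>

definition dyadic_ratio :: "real measure \<Rightarrow> real measure \<Rightarrow> nat \<Rightarrow> int \<Rightarrow> real" where
  "dyadic_ratio K R n i = measure K (dyadic_cell n -` {i}) / measure R (dyadic_cell n -` {i})"

locale dominated_real_measure =
  fixes K R :: "real measure"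
  assumes sets_K [measurable_cong, simp]: "sets K = sets borel"
    and sets_R [measurable_cong, simp]: "sets R = sets borel"
    and finite_R: "finite_measure R"
    and K_le_R: "A \<in> sets borel \<Longrightarrow> emeasure K A \<le> emeasure R A"
begin

sublocale R: finite_measure R by (fact finite_R)

lemma space_K [simp]: "space K = UNIV" using sets_eq_imp_space_eq[OF sets_K] by simp
lemma space_R [simp]: "space R = UNIV" using sets_eq_imp_space_eq[OF sets_R] by simp

lemma finite_K: "finite_measure K"
  using K_le_R[of UNIV] R.emeasure_finite[of UNIV] 
  by (intro finite_measureI) (auto simp: top_unique)

sublocale K: finite_measure K by (fact finite_K)

abbreviation f :: "nat \<Rightarrow> real \<Rightarrow> real" where
  "f n y \<equiv> dyadic_ratio K R n (dyadic_cell n y)"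

lemma ratio_nonneg: "0 \<le> dyadic_ratio K R n i"
  by (simp add: dyadic_ratio_def)

lemma measure_K_le_R: "A \<in> sets borel \<Longrightarrow> measure K A \<le> measure R A"
  using K_le_R[of A] by (simp add: K.emeasure_eq_measure R.emeasure_eq_measure)

lemma ratio_le_1: "dyadic_ratio K R n i \<le> 1"
  using measure_K_le_R[of "dyadic_cell n -` {i}"]
  by (auto simp: dyadic_ratio_def divide_le_eq_1 less_le measure_nonneg)

lemma measurable_f [measurable]: "f n \<in> borel_measurable borel"
  by measurable

text \<open>The cells form a countable space, where a density is just a quotient of point masses.
  The integral identities for the ratios follow from this by change of variables.\<close>

lemma distr_dyadic_cell_eq:
  "distr K (count_space UNIV) (dyadic_cell n) =
   density (distr R (count_space UNIV) (dyadic_cell n)) (\<lambda>i. ennreal (dyadic_ratio K R n i))"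
proof (rule measure_eqI_countable[where A = UNIV])
  fix i :: int
  let ?I = "dyadic_cell n -` {i}"
  have zero: "measure R ?I = 0 \<Longrightarrow> measure K ?I = 0"
    using measure_K_le_R[of ?I] by (simp add: measure_le_0_iff)
  have "emeasure (density (distr R (count_space UNIV) (dyadic_cell n)) (\<lambda>i. ennreal (dyadic_ratio K R n i))) {i}
      = ennreal (dyadic_ratio K R n i) * emeasure R ?I"
    by (subst emeasure_density) (auto simp: nn_integral_cmult_indicator emeasure_distr intro!: nn_integral_cong split: split_indicator
       cong: nn_integral_cong simp flip: indicator_simps)
  then show "emeasure (distr K (count_space UNIV) (dyadic_cell n)) {i} =
      emeasure (density (distr R (count_space UNIV) (dyadic_cell n)) (\<lambda>i. ennreal (dyadic_ratio K R n i))) {i}"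
    using zero by (auto simp: emeasure_distr R.emeasure_eq_measure K.emeasure_eq_measure dyadic_ratio_def ennreal_mult[symmetric])
qed auto

lemma integral_cell_K:
  fixes s :: "int \<Rightarrow> real"
  shows "(\<integral>y. s (dyadic_cell n y) \<partial>K) = (\<integral>y. s (dyadic_cell n y) * f n y \<partial>R)"
proof -
  have "(\<integral>y. s (dyadic_cell n y) \<partial>K) = (\<integral>i. s i \<partial>distr K (count_space UNIV) (dyadic_cell n))"
    by (subst integral_distr) auto
  also have "\<dots> = (\<integral>i. dyadic_ratio K R n i *\<^sub>R s i \<partial>distr R (count_space UNIV) (dyadic_cell n))"
    unfolding distr_dyadic_cell_eq by (subst integral_density) (auto simp: ratio_nonneg)
  also have "\<dots> = (\<integral>y. s (dyadic_cell n y) * f n y \<partial>R)"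
    by (subst integral_distr) (auto simp: mult.commute)
  finally show ?thesis .
qed

text \<open>The martingale property in integrated form, without conditional expectations: on
  functions of coarse cells every finer ratio acts as the density of \<open>K\<close>.\<close>

lemma integral_cell_K_le:
  fixes s :: "int \<Rightarrow> real"
  assumes "m \<le> n"
  shows "(\<integral>y. s (dyadic_cell m y) \<partial>K) = (\<integral>y. s (dyadic_cell m y) * f n y \<partial>R)"
  using integral_cell_K[of "\<lambda>i. s (i div 2 ^ (n - m))" n] by (simp add: dyadic_cell_div[OF assms])

definition energy :: "nat \<Rightarrow> real" where
  "energy n = (\<integral>y. (f n y)\<^sup>2 \<partial>R)"

lemma integrable_bounded:
  fixes g :: "real \<Rightarrow> real"
  assumes "g \<in> borel_measurable borel" "\<And>y. \<bar>g y\<bar> \<le> B"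
  shows "integrable R g"
  using assms by (intro R.integrable_const_bound[where B = B]) auto

lemma integrable_f: "integrable R (f n)"
  by (rule integrable_bounded[where B = 1]) (auto simp: ratio_nonneg ratio_le_1)

lemma integrable_ff: "integrable R (\<lambda>y. f m y * f n y)"
  by (rule integrable_bounded[where B = 1]) (auto simp: abs_mult ratio_nonneg intro!: mult_le_one ratio_le_1)

text \<open>Pythagoras: testing the martingale property with \<open>f m\<close> itself shows that
  the increment from level \<open>m\<close> to \<open>n\<close> is orthogonal to
  \<open>f m\<close>.\<close>

lemma energy_diff:
  assumes "m \<le> n"
  shows "(\<integral>y. (f n y - f m y)\<^sup>2 \<partial>R) = energy n - energy m"
proof -
  have "(\<integral>y. f m y * f n y \<partial>R) = (\<integral>y. f m y * f m y \<partial>R)"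
    using integral_cell_K_le[OF assms, of "dyadic_ratio K R m"] integral_cell_K[of "dyadic_ratio K R m" m] by simp
  moreover have "(\<integral>y. (f n y - f m y)\<^sup>2 \<partial>R) = (\<integral>y. f n y * f n y - 2 * (f m y * f n y) + f m y * f m y \<partial>R)"
    by (simp add: power2_eq_square algebra_simps)
  moreover have "\<dots> = (\<integral>y. f n y * f n y \<partial>R) - 2 * (\<integral>y. f m y * f n y \<partial>R) + (\<integral>y. f m y * f m y \<partial>R)"
    by (simp add: integrable_ff)
  ultimately show ?thesis
    by (simp add: energy_def power2_eq_square)
qed

lemma energy_mono: "m \<le> n \<Longrightarrow> energy m \<le> energy n"
  using energy_diff[of m n] Bochner_Integration.integral_nonneg[of R "\<lambda>y. (f n y - f m y)\<^sup>2"] by simp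

lemma energy_le: "energy n \<le> measure R UNIV"
proof -
  have "energy n \<le> (\<integral>y. 1 \<partial>R)"
    unfolding energy_def power2_eq_square
    by (intro integral_mono integrable_ff) (auto intro!: mult_le_one ratio_nonneg ratio_le_1)
  then show ?thesis by simp
qed

lemma bdd_energy: "bdd_above (range energy)"
  using energy_le by (auto intro!: bdd_aboveI)

text \<open>The ratios form a bounded martingale. A subsequence along which the energies converge
  geometrically fast converges almost everywhere, and this avoids the martingale convergence theorem.\<close>

lemma density_lim_subseq:
  fixes N :: "nat \<Rightarrow> nat"
  assumes N: "\<And>m. m \<le> N m" "\<And>m n. energy n - energy (N m) \<le> (1 / 4) ^ m"
  shows "K = density R (\<lambda>y. ennreal (lim (\<lambda>m. f (N m) y)))"
proof -
  let ?d = "\<lambda>m y. f (N (Suc m)) y - f (N m) y"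
  \<comment> \<open>\<open>N\<close> need not be monotone in \<open>m\<close>, so either index may
    be the larger one. In both cases the energy bound belonging to the smaller index
    applies.\<close>
  have sq: "(\<integral>y. (?d m y)\<^sup>2 \<partial>R) \<le> (1 / 4) ^ m" for m
  proof (cases "N m \<le> N (Suc m)")
    case True
    then show ?thesis using energy_diff[OF True] N(2)[of "N (Suc m)" m] by simp
  next
    case False
    then have "(\<integral>y. (?d m y)\<^sup>2 \<partial>R) = energy (N m) - energy (N (Suc m))"
      using energy_diff[of "N (Suc m)" "N m"] by (simp add: power2_commute)
    also have "\<dots> \<le> (1 / 4) ^ Suc m" by (rule N(2))
    also have "\<dots> \<le> (1 / 4) ^ m" by simp
    finally show ?thesis .
  qed
  have int_d2: "integrable R (\<lambda>y. (?d m y)\<^sup>2)" for m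
    unfolding power2_eq_square by (simp add: algebra_simps integrable_ff)
  have abs_d: "(\<integral>y. \<bar>?d m y\<bar> \<partial>R) \<le> (1 / 2) ^ m * (1 + measure R UNIV)" for m
  proof -
    \<comment> \<open>A weighted inequality of arithmetic and geometric means. The weight
      \<open>2 ^ m\<close> balances the energy gap \<open>(1 / 4) ^ m\<close> against the constant
      term, so that both contribute \<open>(1 / 2) ^ m\<close> and the L1 norms of the increments
      are summable.\<close>
    have "\<bar>x\<bar> \<le> 2 ^ m * x\<^sup>2 + (1 / 2) ^ m" for x :: real
    proof -
      have "0 \<le> (2 ^ m * \<bar>x\<bar> - 1)\<^sup>2" by simp
      then have "2 ^ m * (2 * \<bar>x\<bar>) \<le> 2 ^ m * (2 ^ m * x\<^sup>2 + (1 / 2) ^ m)"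
        by (simp add: power2_eq_square algebra_simps power_divide)
      then have "2 * \<bar>x\<bar> \<le> 2 ^ m * x\<^sup>2 + (1 / 2) ^ m" by simp
      then show ?thesis by linarith
    qed
    then have "(\<integral>y. \<bar>?d m y\<bar> \<partial>R) \<le> (\<integral>y. 2 ^ m * (?d m y)\<^sup>2 + (1 / 2) ^ m \<partial>R)"
      using int_d2 by (intro integral_mono) (auto intro!: integrable_f)
    also have "\<dots> = 2 ^ m * (\<integral>y. (?d m y)\<^sup>2 \<partial>R) + (1 / 2) ^ m * measure R UNIV"
      using int_d2[of m] by simp
    also have "\<dots> \<le> 2 ^ m * (1 / 4) ^ m + (1 / 2) ^ m * measure R UNIV"
      by (intro add_mono mult_left_mono sq) auto
    also have "2 ^ m * (1 / 4) ^ m = ((1 / 2) ^ m :: real)"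
      by (simp flip: power_mult_distrib)
    finally show ?thesis by (simp add: algebra_simps)
  qed
  have "(\<integral>\<^sup>+ y. (\<Sum>m. ennreal \<bar>?d m y\<bar>) \<partial>R) = (\<Sum>m. \<integral>\<^sup>+ y. ennreal \<bar>?d m y\<bar> \<partial>R)"
    by (rule nn_integral_suminf) auto
  also have "\<dots> \<le> (\<Sum>m. ennreal ((1 / 2) ^ m * (1 + measure R UNIV)))"
    using abs_d by (intro suminf_le) (auto simp: nn_integral_eq_integral integrable_f intro!: ennreal_leI)
  also have "\<dots> < \<infinity>"
    by (subst suminf_ennreal2) (auto intro!: summable_mult2 summable_geometric)
  finally have "AE y in R. (\<Sum>m. ennreal \<bar>?d m y\<bar>) \<noteq> \<infinity>"
    by (intro nn_integral_PInf_AE) auto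
  then have lim: "AE y in R. (\<lambda>m. f (N m) y) \<longlonglongrightarrow> lim (\<lambda>m. f (N m) y)"
  proof eventually_elim
    case (elim y)
    then have "summable (\<lambda>m. \<bar>?d m y\<bar>)"
      by (intro summable_suminf_not_top) auto
    then have "summable (\<lambda>m. ?d m y)"
      by (rule summable_rabs_cancel)
    from summable_LIMSEQ[OF this]
    have "(\<lambda>n. f (N n) y - f (N 0) y) \<longlonglongrightarrow> (\<Sum>m. ?d m y)"
      by (simp add: sum_lessThan_telescope[of "\<lambda>n. f (N n) y"])
    from tendsto_add[OF this tendsto_const[of "f (N 0) y"]]
    have "convergent (\<lambda>m. f (N m) y)"
      by (simp add: convergent_def) blast
    then show ?case by (simp add: convergent_LIMSEQ_iff)
  qed
  let ?F = "\<lambda>y. lim (\<lambda>m. f (N m) y)"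
  have F: "?F \<in> borel_measurable borel" by measurable
  have F0: "AE y in R. 0 \<le> ?F y" using lim
    by eventually_elim (auto intro!: LIMSEQ_le_const ratio_nonneg)
  have F1: "AE y in R. ?F y \<le> 1" using lim
    by eventually_elim (auto intro!: LIMSEQ_le_const2 ratio_le_1)
  have intF: "integrable R (\<lambda>y. ?F y * indicator A y)" if A: "A \<in> sets borel" for A
    using F0 F1 A F by (intro R.integrable_const_bound[where B = 1]) (auto simp: indicator_def)
  have emF: "emeasure (density R (\<lambda>y. ennreal (?F y))) A = ennreal (\<integral>y. ?F y * indicator A y \<partial>R)"
    if A: "A \<in> sets borel" for A
  proof -
    have "emeasure (density R (\<lambda>y. ennreal (?F y))) A = (\<integral>\<^sup>+ y. ennreal (?F y * indicator A y) \<partial>R)"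
      using F A by (subst emeasure_density) (auto intro!: nn_integral_cong split: split_indicator)
    also have "\<dots> = ennreal (\<integral>y. ?F y * indicator A y \<partial>R)"
      using F0 by (intro nn_integral_eq_integral intF[OF A]) (auto simp: indicator_def)
    finally show ?thesis .
  qed
  have cell: "emeasure K (dyadic_cell n -` A) = emeasure (density R (\<lambda>y. ennreal (?F y))) (dyadic_cell n -` A)" for n A
  proof -
    let ?A = "dyadic_cell n -` A"
    have "(\<lambda>m. \<integral>y. f (N m) y * indicator ?A y \<partial>R) \<longlonglongrightarrow> (\<integral>y. ?F y * indicator ?A y \<partial>R)"
    proof (rule integral_dominated_convergence[where w = "\<lambda>_. 1"])
      show "AE y in R. (\<lambda>m. f (N m) y * indicator ?A y) \<longlonglongrightarrow> ?F y * indicator ?A y"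
        using lim by eventually_elim (intro tendsto_intros)
    qed (auto simp: indicator_def ratio_nonneg ratio_le_1)
    \<comment> \<open>Once \<open>N m\<close> is at least \<open>n\<close>, the martingale property
      makes this sequence constant, which identifies its limit.\<close>
    moreover have "eventually (\<lambda>m. (\<integral>y. f (N m) y * indicator ?A y \<partial>R) = measure K ?A) sequentially"
      using eventually_ge_at_top[of n]
    proof eventually_elim
      case (elim m)
      have "n \<le> N m" using elim N(1)[of m] by simp
      from integral_cell_K_le[OF this, of "indicator A"]
      have "(\<integral>y. f (N m) y * indicator ?A y \<partial>R) = (\<integral>y. indicator ?A y \<partial>K)"
        by (simp add: indicator_vimage mult.commute)
      then show ?case by simp
    qed
    ultimately have "(\<integral>y. ?F y * indicator ?A y \<partial>R) = measure K ?A"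
      by (intro LIMSEQ_unique[OF _ tendsto_eventually])
    then show ?thesis by (simp add: emF K.emeasure_eq_measure)
  qed
  show ?thesis
  proof (rule measure_eqI_lessThan)
    fix x
    define U where "U n = dyadic_cell n -` {dyadic_cell n x<..}" for n
    have U: "{x<..} = (\<Union>n. U n)"
      unfolding U_def using less_iff_dyadic_cell_less[of x] by auto
    have inc: "incseq U"
      unfolding U_def incseq_def using dyadic_cell_less_mono by auto
    have [measurable]: "U n \<in> sets borel" for n unfolding U_def by measurable
    have "emeasure K {x<..} = (SUP n. emeasure K (U n))"
      unfolding U using inc by (intro SUP_emeasure_incseq[symmetric]) auto
    also have "\<dots> = (SUP n. emeasure (density R (\<lambda>y. ennreal (?F y))) (U n))"
      using cell by (simp add: U_def)
    also have "\<dots> = emeasure (density R (\<lambda>y. ennreal (?F y))) {x<..}"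
      unfolding U using inc by (intro SUP_emeasure_incseq) auto
    finally show "emeasure K {x<..} = emeasure (density R (\<lambda>y. ennreal (?F y))) {x<..}" .
  qed (auto simp: K.emeasure_finite less_top[symmetric])
qed

end

text \<open>The cell index takes countably many values, so it suffices to treat a fixed cell, where
  only the measurability of the kernels in \<open>z\<close> matters.\<close>

lemma dyadic_ratio_measurable:
  assumes K [measurable]: "K \<in> Z \<rightarrow>\<^sub>M subprob_algebra borel" and R [measurable]: "R \<in> Z \<rightarrow>\<^sub>M subprob_algebra borel"
  shows "(\<lambda>(z, y). dyadic_ratio (K z) (R z) n (dyadic_cell n y)) \<in> borel_measurable (Z \<Otimes>\<^sub>M borel)"
  unfolding case_prod_beta
proof (rule measurable_compose_countable[where f = "\<lambda>i p. dyadic_ratio (K (fst p)) (R (fst p)) n i"])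
  fix i
  have "(\<lambda>z. measure (L z) (dyadic_cell n -` {i})) \<in> borel_measurable Z" if "L \<in> Z \<rightarrow>\<^sub>M subprob_algebra borel" for L
    by (rule measurable_compose[OF that measurable_measure_subprob_algebra]) simp
  from this[OF K] this[OF R] show "(\<lambda>p. dyadic_ratio (K (fst p)) (R (fst p)) n i) \<in> borel_measurable (Z \<Otimes>\<^sub>M borel)"
    unfolding dyadic_ratio_def
    by (intro borel_measurable_divide) (rule measurable_compose[OF measurable_fst]; simp)+
qed measurable

lemma dominated_kernel_density_real:
  assumes K [measurable]: "K \<in> Z \<rightarrow>\<^sub>M subprob_algebra borel" and R [measurable]: "R \<in> Z \<rightarrow>\<^sub>M subprob_algebra borel"
    and le: "\<And>z A. z \<in> space Z \<Longrightarrow> A \<in> sets borel \<Longrightarrow> emeasure (K z) A \<le> emeasure (R z) A"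
  obtains F :: "'c \<times> real \<Rightarrow> ennreal" where "F \<in> borel_measurable (Z \<Otimes>\<^sub>M borel)"
    "\<And>z. z \<in> space Z \<Longrightarrow> K z = density (R z) (\<lambda>y. F (z, y))"
proof -
  have dom: "dominated_real_measure (K z) (R z)" if "z \<in> space Z" for z
    using le that sets_kernel[OF K that] sets_kernel[OF R that] subprob_space_kernel[OF R that]
    by (auto simp: dominated_real_measure_def subprob_space_def)
  define f where "f n z y = dyadic_ratio (K z) (R z) n (dyadic_cell n y)" for n z y
  have f [measurable]: "(\<lambda>(z, y). f n z y) \<in> borel_measurable (Z \<Otimes>\<^sub>M borel)" for n
    unfolding f_def by (rule dyadic_ratio_measurable[OF K R])
  \<comment> \<open>The energy as a nonnegative integral against a subprobability kernel, a form in
    which measurability in \<open>z\<close> is immediate.\<close>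
  define E where "E n z = enn2real (\<integral>\<^sup>+ y. ennreal ((f n z y)\<^sup>2) \<partial>R z)" for n z
  have E: "E n z = dominated_real_measure.energy (K z) (R z) n" if "z \<in> space Z" for n z
  proof -
    interpret dominated_real_measure "K z" "R z" using dom[OF that] .
    have "(\<lambda>y. (dyadic_ratio (K z) (R z) n (dyadic_cell n y))\<^sup>2) \<in> borel_measurable (R z)"
      by (subst measurable_cong_sets[OF sets_R refl]) measurable
    then show ?thesis unfolding E_def energy_def f_def by (subst integral_eq_nn_integral) auto
  qed
  have [measurable]: "E n \<in> borel_measurable Z" for n
    unfolding E_def by (intro borel_measurable_enn2real nn_integral_measurable_subprob_algebra2[OF _ R]) measurable
  define S where "S z = (SUP n. E n z)" for z
  have bdd: "bdd_above (range (\<lambda>n. E n z))" if "z \<in> space Z" for z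
    using dominated_real_measure.bdd_energy[OF dom[OF that]] by (simp add: E that)
  have [measurable]: "S \<in> borel_measurable Z"
    unfolding S_def using bdd by (intro borel_measurable_cSUP) auto
  \<comment> \<open>A least index is measurable in \<open>z\<close> because the condition on each
    index is. The conjunct \<open>m \<le> n\<close> makes the levels tend to infinity, which
    identifies the limit on cells; the second conjunct holds for some \<open>n\<close> because the
    energies increase to \<open>S z\<close>.\<close>
  define N where "N m z = (LEAST n. m \<le> n \<and> S z - E n z \<le> (1 / 4) ^ m)" for m z
  have [measurable]: "N m \<in> Z \<rightarrow>\<^sub>M count_space UNIV" for m
    unfolding N_def by measurable
  have N: "m \<le> N m z \<and> S z - E (N m z) z \<le> (1 / 4) ^ m" if z: "z \<in> space Z" for m z
    unfolding N_def
  proof (rule LeastI_ex)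
    have "S z - (1 / 4) ^ m < S z" by simp
    then obtain n where n: "S z - (1 / 4) ^ m < E n z"
      using less_cSUP_iff[OF _ bdd[OF z], of "S z - (1 / 4) ^ m"] unfolding S_def by auto
    have "E n z \<le> E (max m n) z"
      using dominated_real_measure.energy_mono[OF dom[OF z], of n "max m n"] by (simp add: E z)
    then show "\<exists>n. m \<le> n \<and> S z - E n z \<le> (1 / 4) ^ m"
      using n by (intro exI[of _ "max m n"]) auto
  qed
  have conv: "K z = density (R z) (\<lambda>y. ennreal (lim (\<lambda>m. f (N m z) z y)))" if z: "z \<in> space Z" for z
    unfolding f_def
  proof (rule dominated_real_measure.density_lim_subseq[OF dom[OF z]])
    show "m \<le> N m z" for m using N[OF z] by simp
    fix m n
    have "E n z \<le> S z" unfolding S_def using bdd[OF z] by (rule cSUP_upper2) auto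
    then show "dominated_real_measure.energy (K z) (R z) n - dominated_real_measure.energy (K z) (R z) (N m z) \<le> (1 / 4) ^ m"
      using N[OF z, of m] by (simp add: E z)
  qed
  have [measurable]: "(\<lambda>p. f (N m (fst p)) (fst p) (snd p)) \<in> borel_measurable (Z \<Otimes>\<^sub>M borel)" for m
    using f by (intro measurable_compose_countable[where f = "\<lambda>n p. f n (fst p) (snd p)" and g = "\<lambda>p. N m (fst p)"])
       (auto simp: case_prod_beta)
  show thesis
  proof (rule that)
    show "(\<lambda>p. ennreal (lim (\<lambda>m. f (N m (fst p)) (fst p) (snd p)))) \<in> borel_measurable (Z \<Otimes>\<^sub>M borel)"
      by measurable
  qed (use conv in simp)
qed

section \<open>Standard Borel spaces as measurable retracts of the line\<close>

text \<open>Half the usual parametrisation of the Cantor set. With digits 0 and 1 in base three, the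
  tail after a digit is at most half a unit of that digit, so there are no carries and no ambiguous
  expansions, unlike in base two.\<close>

definition ternary :: "(nat \<Rightarrow> bool) \<Rightarrow> real" where
  "ternary b = (\<Sum>k. of_bool (b k) * (1 / 3) ^ Suc k)"

definition ternary_digit :: "real \<Rightarrow> nat \<Rightarrow> bool" where
  "ternary_digit r k \<longleftrightarrow> \<lfloor>3 ^ Suc k * r\<rfloor> mod 3 = 1"

lemma suminf_third_powers: "(\<Sum>k. (1 / 3 :: real) ^ (k + n)) = (1 / 3) ^ n * (3 / 2)"
  by (simp add: power_add suminf_mult2[symmetric] suminf_geometric)

lemma summable_ternary: "summable (\<lambda>k. of_bool (b k) * (1 / 3 :: real) ^ Suc k)"
  by (rule summable_comparison_test'[of "\<lambda>k. (1 / 3) ^ k" 0])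
     (auto simp: summable_geometric)

lemma ternary_nonneg: "0 \<le> ternary b"
  unfolding ternary_def by (intro suminf_nonneg summable_ternary) auto

lemma ternary_le: "ternary b \<le> 1 / 2"
proof -
  have "ternary b \<le> (\<Sum>k. (1 / 3 :: real) ^ (k + 1))"
    unfolding ternary_def
    by (intro suminf_le summable_ternary) (auto intro!: summable_mult summable_geometric)
  then show ?thesis using suminf_third_powers[of 1] by simp
qed

text \<open>After scaling by \<open>3 ^ Suc k\<close> the earlier digits contribute a multiple of 3,
  digit \<open>k\<close> stands in the units place, and the tail lies between 0 and 1/2, so the
  floor removes exactly the tail.\<close>

lemma ternary_digit_ternary: "ternary_digit (ternary b) k = b k"
proof -
  let ?t = "\<lambda>j. of_bool (b j) * (1 / 3 :: real) ^ Suc j"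
  let ?T = "\<Sum>j. ?t (j + Suc k)"
  have split: "ternary b = (\<Sum>j<Suc k. ?t j) + ?T"
    unfolding ternary_def by (subst suminf_split_initial_segment[OF summable_ternary, of _ "Suc k"]) simp
  define I :: int where "I = (\<Sum>j<k. of_bool (b j) * 3 ^ (k - Suc j))"
  have "3 ^ Suc k * ?t j = 3 * (of_bool (b j) * 3 ^ (k - Suc j))" if "j < k" for j
  proof -
    have "(3::real) ^ Suc k = 3 ^ Suc j * 3 ^ Suc (k - Suc j)"
      using that by (subst power_add[symmetric]) simp
    then show ?thesis by (simp add: power_one_over)
  qed
  then have "3 ^ Suc k * (\<Sum>j<k. ?t j) = 3 * of_int I"
    by (simp add: I_def sum_distrib_left del: power_Suc)
  moreover have "3 ^ Suc k * ?t k = of_bool (b k)" by (simp add: power_one_over)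
  ultimately have head: "3 ^ Suc k * (\<Sum>j<Suc k. ?t j) = of_int (3 * I + of_bool (b k))"
    by (simp add: distrib_left del: power_Suc)
  have summ: "summable (\<lambda>j. ?t (j + Suc k))"
    using summable_ternary by (subst summable_iff_shift)
  have "?T \<le> (\<Sum>j. (1 / 3 :: real) ^ (j + Suc (Suc k)))"
    by (intro suminf_le summ) (auto simp: summable_geometric power_add intro!: summable_mult summable_mult2)
  also have "\<dots> = (1 / 3) ^ Suc k / 2"
    by (subst suminf_third_powers) simp
  finally have "3 ^ Suc k * ?T \<le> 3 ^ Suc k * ((1 / 3) ^ Suc k / 2)"
    by (intro mult_left_mono) auto
  then have T1: "3 ^ Suc k * ?T \<le> 1 / 2"
    by (simp add: power_one_over)
  have T0: "0 \<le> 3 ^ Suc k * ?T"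
    by (intro mult_nonneg_nonneg suminf_nonneg summ) auto
  have "3 ^ Suc k * ternary b = of_int (3 * I + of_bool (b k)) + 3 ^ Suc k * ?T"
    unfolding split distrib_left head ..
  then have "\<lfloor>3 ^ Suc k * ternary b\<rfloor> = 3 * I + of_bool (b k)"
    using T0 T1 by (intro floor_unique) linarith+
  then show ?thesis
    unfolding ternary_digit_def by (simp add: mod_mult_self4)
qed

lemma measurable_ternary:
  assumes [measurable]: "\<And>k. Measurable.pred M (\<lambda>x. b x k)"
  shows "(\<lambda>x. ternary (b x)) \<in> borel_measurable M"
  unfolding ternary_def by measurable

lemma measurable_ternary_digit [measurable]: "Measurable.pred borel (\<lambda>r. ternary_digit r k)"
  unfolding ternary_digit_def by measurable

text \<open>A point is encoded by the digits telling which balls of radius \<open>2\<^sup>-\<^sup>n\<close> around the points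
  of a dense sequence contain it. Decoding takes the limit of the first admissible centres.\<close>

lemma standard_borel_retract:
  assumes "standard_borel M"
  obtains e d where "e \<in> M \<rightarrow>\<^sub>M (borel :: real measure)" "d \<in> borel \<rightarrow>\<^sub>M M"
    "\<And>x. x \<in> space M \<Longrightarrow> d (e x) = x" "\<And>x. x \<in> space M \<Longrightarrow> 0 < e x" "\<And>x. x \<in> space M \<Longrightarrow> e x < 1"
proof -
  from assms obtain \<delta> where "Metric_space (space M) \<delta>"
    and compl: "Metric_space.mcomplete (space M) \<delta>"
    and sep: "separable_space (Metric_space.mtopology (space M) \<delta>)"
    and sets: "sets M = sigma_sets (space M) {U. openin (Metric_space.mtopology (space M) \<delta>) U}"
    and ne: "space M \<noteq> {}"
    unfolding standard_borel_def by blast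
  interpret Metric_space "space M" \<delta> by fact
  obtain D where D: "countable D" "D \<subseteq> space M" "mtopology closure_of D = space M"
    using sep unfolding separable_space_def by auto
  have "D \<noteq> {}" using D(3) ne by auto
  define q where "q = from_nat_into D"
  have qD: "range q = D" unfolding q_def using \<open>D \<noteq> {}\<close> D(1) by simp
  have qM: "q i \<in> space M" for i using qD D(2) by auto
  have dense: "\<exists>i. \<delta> x (q i) < r" if "x \<in> space M" "0 < r" for x r
  proof -
    have "x \<in> mtopology closure_of D" using that D(3) by simp
    then show ?thesis unfolding metric_closure_of using that qD by auto
  qed
  have ball_sets: "mball (q i) r \<in> sets M" for i r
    unfolding sets by (rule sigma_sets.Basic) auto
  have meas_dist [measurable]: "(\<lambda>x. \<delta> x (q i)) \<in> borel_measurable M" for i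
  proof (rule borel_measurableI_less)
    fix r
    have "{x \<in> space M. \<delta> x (q i) < r} = mball (q i) r"
      using qM by (auto simp: commute)
    then show "{x \<in> space M. \<delta> x (q i) < r} \<in> sets M" using ball_sets by simp
  qed
  define near where "near x k \<longleftrightarrow> (case prod_decode k of (n, i) \<Rightarrow> \<delta> x (q i) < (1 / 2) ^ n)" for x k
  have near: "near x (prod_encode (n, i)) \<longleftrightarrow> \<delta> x (q i) < (1 / 2) ^ n" for x n i
    by (simp add: near_def)
  have [measurable]: "Measurable.pred M (\<lambda>x. near x k)" for k
    unfolding near_def by (cases "prod_decode k") simp
  \<comment> \<open>The shift by 1/4 moves the values from [0, 1/2] into [1/4, 3/4]. Strict
    positivity leaves 0 free as a value that codes no point.\<close>
  define e where "e x = 1 / 4 + ternary (near x)" for x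
  have e: "e \<in> borel_measurable M"
    unfolding e_def by (intro borel_measurable_add measurable_ternary) auto
  define a where "a n r = (LEAST i. ternary_digit (r - 1 / 4) (prod_encode (n, i)))" for n r
  have [measurable]: "a n \<in> borel \<rightarrow>\<^sub>M count_space UNIV" for n
    unfolding a_def by measurable
  define s where "s r n = q (a n r)" for r n
  have sM: "s r n \<in> space M" for r n by (simp add: s_def qM)
  \<comment> \<open>The codes whose decoded centres satisfy the estimate that genuine codes satisfy
    by the triangle inequality through the coded point. It forces a Cauchy sequence, and
    \<open>C\<close> is measurable, so \<open>d\<close> becomes total with the default
    \<open>q 0\<close> elsewhere.\<close>
  define C where "C = {r. \<forall>m n. \<delta> (s r m) (s r n) \<le> (1 / 2) ^ m + (1 / 2) ^ n}"
  define d where "d r = (if r \<in> C then SOME x. limitin mtopology (s r) x sequentially else q 0)" for r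
  have [measurable]: "C \<in> sets borel"
  proof -
    have "(\<lambda>r. \<delta> (s r m) (s r n)) \<in> borel_measurable borel" for m n
      unfolding s_def
      by (rule measurable_compose_countable[where f = "\<lambda>i r. \<delta> (q i) (q (a n r))" and g = "a m"])
         (auto intro!: measurable_compose_countable[where f = "\<lambda>j r. \<delta> _ (q j)" and g = "a n"])
    note this[measurable]
    show ?thesis unfolding C_def by measurable
  qed
  have lim: "limitin mtopology (s r) (d r) sequentially" if "r \<in> C" for r
  proof -
    have "MCauchy (s r)"
      unfolding MCauchy_def
    proof (intro conjI allI impI)
      show "range (s r) \<subseteq> space M" using sM by auto
      fix \<epsilon> :: real assume "0 < \<epsilon>"
      then obtain N where N: "(1 / 2) ^ N < \<epsilon> / 2"
        using real_arch_pow_inv[of "\<epsilon> / 2" "1 / 2"] by auto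
      have "\<delta> (s r n) (s r n') < \<epsilon>" if "N \<le> n" "N \<le> n'" for n n'
      proof -
        have "(1 / 2 :: real) ^ n \<le> (1 / 2) ^ N" "(1 / 2 :: real) ^ n' \<le> (1 / 2) ^ N"
          using that by (auto intro!: power_decreasing)
        moreover have "\<delta> (s r n) (s r n') \<le> (1 / 2) ^ n + (1 / 2) ^ n'"
          using \<open>r \<in> C\<close> by (simp add: C_def)
        ultimately show ?thesis using N by linarith
      qed
      then show "\<exists>N. \<forall>n n'. N \<le> n \<longrightarrow> N \<le> n' \<longrightarrow> \<delta> (s r n) (s r n') < \<epsilon>" by blast
    qed
    then have "\<exists>x. limitin mtopology (s r) x sequentially"
      using compl unfolding mcomplete_def by blast
    from someI_ex[OF this] show ?thesis using that by (simp add: d_def)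
  qed
  have dM: "d r \<in> space M" for r
    using lim[of r] limitin_mspace by (cases "r \<in> C") (auto simp: d_def qM)
  have lim_dist: "(\<lambda>n. \<delta> (s r n) (q i)) \<longlonglongrightarrow> \<delta> (d r) (q i)" if "r \<in> C" for r i
  proof -
    have null: "(\<lambda>n. \<delta> (s r n) (d r)) \<longlonglongrightarrow> 0"
      using lim[OF that] unfolding limitin_metric_dist_null by blast
    have "norm (\<delta> (s r n) (q i) - \<delta> (d r) (q i)) \<le> \<delta> (s r n) (d r)" for n
      using mdist_reverse_triangle[OF sM[of r n] qM[of i] dM[of r]] commute[of "q i" "d r"] by simp
    then have "(\<lambda>n. \<delta> (s r n) (q i) - \<delta> (d r) (q i)) \<longlonglongrightarrow> 0"
      by (intro Lim_null_comparison[OF _ null] always_eventually) auto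
    then show ?thesis by (rule Lim_null[THEN iffD2])
  qed
  have dist_d: "(\<lambda>r. \<delta> (d r) (q i)) \<in> borel_measurable borel" for i
  proof -
    have "(\<lambda>r. \<delta> (s r n) (q i)) \<in> borel_measurable borel" for n
      unfolding s_def
      by (rule measurable_compose_countable[where f = "\<lambda>j r. \<delta> (q j) (q i)" and g = "a n"]) auto
    note this[measurable]
    have "(\<lambda>r. if r \<in> C then lim (\<lambda>n. \<delta> (s r n) (q i)) else \<delta> (q 0) (q i)) \<in> borel_measurable borel"
      by measurable
    also have "(\<lambda>r. if r \<in> C then lim (\<lambda>n. \<delta> (s r n) (q i)) else \<delta> (q 0) (q i)) = (\<lambda>r. \<delta> (d r) (q i))"
      using lim_dist by (auto simp: fun_eq_iff limI d_def)
    finally show ?thesis .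
  qed
  have d: "d \<in> borel \<rightarrow>\<^sub>M M"
  proof (rule measurable_sigma_sets[OF sets])
    show "{U. openin mtopology U} \<subseteq> Pow (space M)"
      using openin_subset by fastforce
    show "d \<in> space borel \<rightarrow> space M" using dM by auto
    fix U assume "U \<in> {U. openin mtopology U}"
    then have U: "U \<subseteq> space M" "\<And>x. x \<in> U \<Longrightarrow> \<exists>r>0. mball x r \<subseteq> U"
      unfolding openin_mtopology by auto
    \<comment> \<open>An open set is the union of the balls of radius \<open>(1 / 2) ^ n\<close>
      around dense points that it contains. There are countably many of them, so measurability of
      \<open>d\<close> reduces to that of the distances to the \<open>q i\<close>.\<close>
    let ?P = "{(i, n). mball (q i) ((1 / 2) ^ n) \<subseteq> U}"
    have "\<exists>(i, n)\<in>?P. \<delta> x (q i) < (1 / 2) ^ n" if x: "x \<in> U" for x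
    proof -
      obtain r where r: "0 < r" "mball x r \<subseteq> U" using U(2)[OF x] by auto
      obtain n where n: "(1 / 2) ^ n < r / 2" using real_arch_pow_inv[of "r / 2" "1 / 2"] r by auto
      obtain i where i: "\<delta> x (q i) < (1 / 2) ^ n" using dense[of x "(1 / 2) ^ n"] x U(1) by auto
      have "mball (q i) ((1 / 2) ^ n) \<subseteq> mball x r"
        using i n x U(1) by (intro mball_subset) (auto simp: commute)
      then show ?thesis using i r by auto
    qed
    then have "d -` U = (\<Union>(i, n)\<in>?P. {r. \<delta> (d r) (q i) < (1 / 2) ^ n})"
      using dM qM by (auto simp: subset_iff commute)
    moreover have "\<dots> \<in> sets borel"
      using dist_d by (intro sets.countable_UN'') (auto split: prod.splits)
    ultimately show "d -` U \<inter> space borel \<in> sets borel" by simp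
  qed
  have de: "d (e x) = x" if x: "x \<in> space M" for x
  proof -
    have "\<delta> x (s (e x) n) < (1 / 2) ^ n" for n
    proof -
      have *: "ternary_digit (e x - 1 / 4) (prod_encode (n, i)) \<longleftrightarrow> \<delta> x (q i) < (1 / 2) ^ n" for i
        by (simp add: e_def ternary_digit_ternary near)
      show ?thesis
        unfolding s_def a_def * using dense[OF x, of "(1 / 2) ^ n"] by (auto intro: LeastI_ex)
    qed
    note close = this
    have "e x \<in> C"
      unfolding C_def
    proof (intro CollectI allI)
      fix m n
      have "\<delta> (s (e x) m) (s (e x) n) \<le> \<delta> (s (e x) m) x + \<delta> x (s (e x) n)"
        using x sM by (intro triangle) auto
      then show "\<delta> (s (e x) m) (s (e x) n) \<le> (1 / 2) ^ m + (1 / 2) ^ n"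
        using close[of m] close[of n] by (simp add: commute)
    qed
    moreover have "limitin mtopology (s (e x)) x sequentially"
      unfolding limitin_metric_dist_null
    proof (intro conjI)
      have "(\<lambda>n. (1 / 2 :: real) ^ n) \<longlonglongrightarrow> 0" by (rule LIMSEQ_realpow_zero) auto
      then show "(\<lambda>n. \<delta> (s (e x) n) x) \<longlonglongrightarrow> 0"
        using close by (intro Lim_null_comparison[of "\<lambda>n. \<delta> (s (e x) n) x" "\<lambda>n. (1 / 2) ^ n"] always_eventually)
          (auto simp: commute less_imp_le)
    qed (use x sM in auto)
    ultimately show ?thesis
      using lim limitin_metric_unique trivial_limit_sequentially by blast
  qed
  show thesis
  proof (rule that[OF e d de])
    show "0 < e x" for x using ternary_nonneg[of "near x"] by (simp add: e_def)
    show "e x < 1" for x using ternary_le[of "near x"] by (simp add: e_def)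
  qed
qed

section \<open>Densities and disintegrations of subprobability kernels\<close>

text \<open>Transport along \<open>e\<close> loses nothing: since \<open>d\<close> is a left
  inverse, every measurable set is the preimage under \<open>e\<close> of a Borel set. The density
  on \<open>Y\<close> is the one on the line composed with \<open>e\<close>.\<close>

lemma dominated_kernel_density:
  assumes Y: "standard_borel Y"
    and K [measurable]: "K \<in> Z \<rightarrow>\<^sub>M subprob_algebra Y" and R [measurable]: "R \<in> Z \<rightarrow>\<^sub>M subprob_algebra Y"
    and le: "\<And>z A. z \<in> space Z \<Longrightarrow> A \<in> sets Y \<Longrightarrow> emeasure (K z) A \<le> emeasure (R z) A"
  obtains F :: "'c \<times> 'b \<Rightarrow> ennreal" where "F \<in> borel_measurable (Z \<Otimes>\<^sub>M Y)"
    "\<And>z. z \<in> space Z \<Longrightarrow> K z = density (R z) (\<lambda>y. F (z, y))"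
proof -
  obtain e d where e [measurable]: "e \<in> Y \<rightarrow>\<^sub>M (borel :: real measure)" and d [measurable]: "d \<in> borel \<rightarrow>\<^sub>M Y"
    and de: "\<And>y. y \<in> space Y \<Longrightarrow> d (e y) = y"
    using standard_borel_retract[OF Y] by metis
  have distr: "(\<lambda>z. distr (L z) borel e) \<in> Z \<rightarrow>\<^sub>M subprob_algebra borel" if "L \<in> Z \<rightarrow>\<^sub>M subprob_algebra Y" for L
    by (rule measurable_compose[OF that measurable_distr[OF e]])
  obtain F where F [measurable]: "F \<in> borel_measurable (Z \<Otimes>\<^sub>M borel)"
    and F_eq: "\<And>z. z \<in> space Z \<Longrightarrow> distr (K z) borel e = density (distr (R z) borel e) (\<lambda>y. F (z, y))"
  proof (rule dominated_kernel_density_real[OF distr[OF K] distr[OF R]])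
    fix z and A :: "real set" assume z: "z \<in> space Z" and A: "A \<in> sets borel"
    note sets = sets_kernel[OF K z] sets_kernel[OF R z]
    have "e \<in> borel_measurable (K z)" "e \<in> borel_measurable (R z)"
      using e by (simp_all add: measurable_cong_sets[OF sets(1) refl] measurable_cong_sets[OF sets(2) refl])
    then show "emeasure (distr (K z) borel e) A \<le> emeasure (distr (R z) borel e) A"
      using A le[OF z, of "e -` A \<inter> space Y"] sets_eq_imp_space_eq[OF sets(1)] sets_eq_imp_space_eq[OF sets(2)]
      by (simp add: emeasure_distr)
  qed blast
  show thesis
  proof (rule that[of "\<lambda>(z, y). F (z, e y)"])
    fix z assume z: "z \<in> space Z"
    note sets [measurable_cong, simp] = sets_kernel[OF K z] sets_kernel[OF R z]
    note sp = sets_eq_imp_space_eq[OF sets(1)] sets_eq_imp_space_eq[OF sets(2)]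
    have [measurable]: "(\<lambda>y. F (z, y)) \<in> borel_measurable borel"
      using z by (rule measurable_Pair2[OF F])
    have e' [measurable]: "e \<in> borel_measurable (K z)" "e \<in> borel_measurable (R z)"
      using e by (simp_all add: measurable_cong_sets[OF sets(1) refl] measurable_cong_sets[OF sets(2) refl])
    have "K z = density (R z) (\<lambda>y. F (z, e y))"
    proof (rule measure_eqI)
      fix A assume "A \<in> sets (K z)"
      then have A [measurable]: "A \<in> sets Y" by simp
      have dA [measurable]: "d -` A \<in> sets borel"
        using measurable_sets[OF d A] by simp
      have "emeasure (K z) A = emeasure (distr (K z) borel e) (d -` A)"
        using sets.sets_into_space[OF A] de by (subst emeasure_distr) (auto simp: sp intro!: arg_cong[where f = "emeasure _"])
      also have "\<dots> = (\<integral>\<^sup>+ y. F (z, e y) * indicator (d -` A) (e y) \<partial>R z)"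
        unfolding F_eq[OF z] by (subst emeasure_density) (auto simp: nn_integral_distr)
      also have "\<dots> = (\<integral>\<^sup>+ y. F (z, e y) * indicator A y \<partial>R z)"
        using de by (intro nn_integral_cong) (auto simp: sp split: split_indicator)
      also have "\<dots> = emeasure (density (R z) (\<lambda>y. F (z, e y))) A"
        by (subst emeasure_density) auto
      finally show "emeasure (K z) A = emeasure (density (R z) (\<lambda>y. F (z, e y))) A" .
    qed simp
    then show "K z = density (R z) (\<lambda>y. case (z, y) of (z, y) \<Rightarrow> F (z, e y))" by simp
  qed measurable
qed

text \<open>The difference of the densities is integrated over the set where the inequality fails;
  finiteness of the larger measure is what permits the subtraction.\<close>

lemma AE_le_of_density_le:
  assumes [measurable]: "f \<in> borel_measurable M" "g \<in> borel_measurable M"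
    and fin: "emeasure (density M g) (space M) < \<infinity>"
    and le: "\<And>A. A \<in> sets M \<Longrightarrow> emeasure (density M f) A \<le> emeasure (density M g) A"
  shows "AE x in M. f x \<le> g x"
proof -
  define N where "N = {x \<in> space M. g x < f x}"
  have [measurable]: "N \<in> sets M" unfolding N_def by measurable
  have "(\<integral>\<^sup>+ x. g x * indicator N x \<partial>M) \<le> (\<integral>\<^sup>+ x. g x * indicator (space M) x \<partial>M)"
    using sets.sets_into_space[of N M] by (intro nn_integral_mono) (auto split: split_indicator)
  then have gfin: "(\<integral>\<^sup>+ x. g x * indicator N x \<partial>M) \<noteq> \<infinity>"
    using fin by (auto simp: emeasure_density top_unique)
  have "(\<integral>\<^sup>+ x. f x * indicator N x - g x * indicator N x \<partial>M) = 
      (\<integral>\<^sup>+ x. f x * indicator N x \<partial>M) - (\<integral>\<^sup>+ x. g x * indicator N x \<partial>M)"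
    using gfin by (intro nn_integral_diff) (auto simp: N_def split: split_indicator)
  also have "\<dots> = 0"
    using le[of N] gfin by (simp add: emeasure_density diff_eq_0_iff_ennreal less_top le_less_trans)
  finally have "AE x in M. f x * indicator N x - g x * indicator N x = 0"
    by (subst (asm) nn_integral_0_iff_AE) auto
  then show ?thesis
    using AE_space
  proof eventually_elim
    case (elim x)
    then show ?case
      by (cases "x \<in> N") (auto simp: N_def diff_eq_0_iff_ennreal not_less)
  qed
qed

section \<open>Disintegration by quantile functions\<close>

text \<open>The set is an interval starting at 0 and ending at the supremum, cut off at 1; whether
  it contains its end depends on attainment, which Lebesgue measure ignores. This computes the tails
  of the quantile function.\<close>

lemma emeasure_unit_interval_hypograph:
  fixes g :: "'i \<Rightarrow> ennreal"
  shows "emeasure lborel {t. 0 < t \<and> t < 1 \<and> (\<exists>c\<in>C. ennreal t \<le> g c)} = min 1 (SUP c\<in>C. g c)"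
proof -
  let ?S = "{t. 0 < t \<and> t < 1 \<and> (\<exists>c\<in>C. ennreal t \<le> g c)}"
  have mem: "t \<in> ?S" if "0 < t" "t < 1" "ennreal t < (SUP c\<in>C. g c)" for t
    using that by (auto simp: less_SUP_iff intro: less_imp_le)
  show ?thesis
  proof (cases "1 \<le> (SUP c\<in>C. g c)")
    case True
    have "?S = {0<..<1}"
    proof (intro equalityI subsetI)
      fix t :: real assume t: "t \<in> {0<..<1}"
      then have "ennreal t < 1" by (simp add: ennreal_less_one_iff)
      from this True have "ennreal t < (SUP c\<in>C. g c)" by (rule less_le_trans)
      with t show "t \<in> ?S" by (intro mem) auto
    qed auto
    then show ?thesis using True by (simp add: min_absorb1)
  next
    case False
    then obtain r where r: "(SUP c\<in>C. g c) = ennreal r" "0 \<le> r" "r < 1"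
      by (cases "SUP c\<in>C. g c") (auto simp: ennreal_less_one_iff not_le)
    have "{0<..<r} \<subseteq> ?S"
    proof
      fix t assume "t \<in> {0<..<r}"
      then show "t \<in> ?S" using r by (intro mem) (auto simp: ennreal_less_iff)
    qed
    moreover have S: "?S \<subseteq> {0<..r}"
    proof
      fix t assume "t \<in> ?S"
      then obtain c where "c \<in> C" "ennreal t \<le> g c" "0 < t" by auto
      then have "ennreal t \<le> ennreal r" unfolding r(1)[symmetric] by (auto intro: SUP_upper2)
      then show "t \<in> {0<..r}" using r \<open>0 < t\<close> by auto
    qed
    moreover have "{0<..r} \<subseteq> insert r {0<..<r}" by auto
    ultimately have "?S = {0<..<r} \<or> ?S = {0<..r}" by blast
    moreover have "emeasure lborel {0<..<r} = ennreal r" "emeasure lborel {0<..r} = ennreal r"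
      using r(2) by simp_all
    ultimately have "emeasure lborel ?S = ennreal r"
      by (elim disjE) (simp_all only:)
    moreover have "min 1 (SUP c\<in>C. g c) = ennreal r"
      using False unfolding r(1) by (simp add: min_def)
    ultimately show ?thesis by (simp only:)
  qed
qed

text \<open>For every \<open>p\<close> in \<open>Z \<Otimes>\<^sub>M Y\<close> the measure
  \<open>q p\<close> is a subprobability measure, with no exceptional points; only the comparison of
  integrals uses that the tail functions are monotone and at most 1 almost everywhere. The set
  \<open>V\<close> in the conclusion records the joint law of a point and its image, from which
  concentration on fibres is later read off.\<close>

lemma subprob_disintegration:
  assumes X: "standard_borel X" and Y: "standard_borel Y"
    and mu: "\<mu> \<in> Z \<rightarrow>\<^sub>M subprob_algebra X" and rho: "\<rho> \<in> Z \<rightarrow>\<^sub>M subprob_algebra Y"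
    and phi [measurable]: "\<phi> \<in> X \<rightarrow>\<^sub>M Y"
    and le: "\<And>z V. z \<in> space Z \<Longrightarrow> V \<in> sets Y \<Longrightarrow> emeasure (\<mu> z) (\<phi> -` V \<inter> space X) \<le> emeasure (\<rho> z) V"
  obtains q where "q \<in> Z \<Otimes>\<^sub>M Y \<rightarrow>\<^sub>M subprob_algebra X"
    "\<And>z U V. z \<in> space Z \<Longrightarrow> U \<in> sets X \<Longrightarrow> V \<in> sets Y \<Longrightarrow>
       (\<integral>\<^sup>+ y\<in>V. emeasure (q (z, y)) U \<partial>\<rho> z) = emeasure (\<mu> z) (U \<inter> \<phi> -` V)"
proof -
  obtain e d where e [measurable]: "e \<in> X \<rightarrow>\<^sub>M (borel :: real measure)" and d [measurable]: "d \<in> borel \<rightarrow>\<^sub>M X"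
    and de: "\<And>x. x \<in> space X \<Longrightarrow> d (e x) = x" and e01: "\<And>x. x \<in> space X \<Longrightarrow> 0 < e x" "\<And>x. x \<in> space X \<Longrightarrow> e x < 1"
    using standard_borel_retract[OF X] by metis
  have Y_ne: "space Y \<noteq> {}" and X_ne: "space X \<noteq> {}"
    using X Y by (simp_all add: standard_borel_def)
  define K where "K c z = distr (density (\<mu> z) (indicator {x \<in> space X. c < e x})) Y \<phi>" for c z
  have K_emeasure: "emeasure (K c z) V = emeasure (\<mu> z) ({x \<in> space X. c < e x} \<inter> (\<phi> -` V \<inter> space X))"
    if z: "z \<in> space Z" and V: "V \<in> sets Y" for c z V
  proof -
    note [measurable_cong, simp] = sets_kernel[OF mu z]
    note [simp] = sets_eq_imp_space_eq[OF sets_kernel[OF mu z]]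
    show ?thesis
      using V unfolding K_def by (subst emeasure_distr) (auto simp: emeasure_restricted)
  qed
  have K_le: "emeasure (K c z) V \<le> emeasure (\<rho> z) V" if z: "z \<in> space Z" and V: "V \<in> sets Y" for c z V
  proof -
    have "emeasure (K c z) V \<le> emeasure (\<mu> z) (\<phi> -` V \<inter> space X)"
      using V by (auto simp: K_emeasure z sets_kernel[OF mu z] intro!: emeasure_mono)
    also have "\<dots> \<le> emeasure (\<rho> z) V" by (rule le[OF z V])
    finally show ?thesis .
  qed
  have K: "K c \<in> Z \<rightarrow>\<^sub>M subprob_algebra Y" for c
  proof (rule measurable_subprob_algebra)
    fix z assume z: "z \<in> space Z"
    show "sets (K c z) = sets Y" by (simp add: K_def)
    interpret subprob_space "\<rho> z" by (rule subprob_space_kernel[OF rho z])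
    show "subprob_space (K c z)"
    proof (rule subprob_spaceI)
      show "emeasure (K c z) (space (K c z)) \<le> 1"
        using order_trans[OF K_le[OF z sets.top] subprob_emeasure_le_1] by (simp add: K_def)
    qed (simp add: K_def Y_ne)
  next
    fix V assume "V \<in> sets Y"
    then show "(\<lambda>z. emeasure (K c z) V) \<in> borel_measurable Z"
      using mu by (subst measurable_cong[OF K_emeasure]) (auto intro!: measurable_emeasure_kernel[OF mu])
  qed
  have "\<exists>F. F \<in> borel_measurable (Z \<Otimes>\<^sub>M Y) \<and> (\<forall>z\<in>space Z. K c z = density (\<rho> z) (\<lambda>y. F (z, y)))" for c
    using dominated_kernel_density[OF Y K rho K_le] by metis
  then obtain F where F [measurable]: "\<And>c. F c \<in> borel_measurable (Z \<Otimes>\<^sub>M Y)"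
    and KF: "\<And>c z. z \<in> space Z \<Longrightarrow> K c z = density (\<rho> z) (\<lambda>y. F c (z, y))"
    by metis
  define C where "C = \<rat> \<inter> {0..1::real}"
  have C: "countable C" unfolding C_def using countable_rat by auto
  \<comment> \<open>A quantile function in \<open>t\<close>: the supremum of the rational levels
    whose tail is at least \<open>t\<close>. The inserted 0 keeps the set nonempty, and the supremum
    turns \<open>x < Q p t\<close> into a countable disjunction, which gives joint
    measurability.\<close>
  define Q where "Q p t = Sup (insert 0 {c \<in> C. ennreal t \<le> F c p})" for p t
  have bdd: "bdd_above (insert 0 {c \<in> C. ennreal t \<le> F c p})" for t p
    by (auto simp: C_def intro!: bdd_aboveI[of _ 1])
  have Q_greater: "x < Q p t \<longleftrightarrow> x < 0 \<or> (\<exists>c\<in>{c \<in> C. x < c}. ennreal t \<le> F c p)" for x p t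
    unfolding Q_def by (subst less_cSup_iff[OF _ bdd]) auto
  have Q [measurable]: "(\<lambda>(p, t). Q p t) \<in> borel_measurable ((Z \<Otimes>\<^sub>M Y) \<Otimes>\<^sub>M borel)"
  proof (rule borel_measurableI_greater)
    fix x
    have "{w \<in> space ((Z \<Otimes>\<^sub>M Y) \<Otimes>\<^sub>M borel). x < (case w of (p, t) \<Rightarrow> Q p t)} =
        (if x < 0 then space ((Z \<Otimes>\<^sub>M Y) \<Otimes>\<^sub>M borel) else
         (\<Union>c\<in>{c \<in> C. x < c}. {w \<in> space ((Z \<Otimes>\<^sub>M Y) \<Otimes>\<^sub>M borel). ennreal (snd w) \<le> F c (fst w)}))"
      by (auto simp: Q_greater)
    also have "\<dots> \<in> sets ((Z \<Otimes>\<^sub>M Y) \<Otimes>\<^sub>M borel)"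
      using C by (auto intro!: sets.countable_UN'')
    finally show "{w \<in> space ((Z \<Otimes>\<^sub>M Y) \<Otimes>\<^sub>M borel). x < (case w of (p, t) \<Rightarrow> Q p t)} \<in> sets ((Z \<Otimes>\<^sub>M Y) \<Otimes>\<^sub>M borel)" .
  qed
  \<comment> \<open>Where the quantile falls back to 0 it codes no point, as \<open>e\<close> is
    positive. Dropping these \<open>t\<close> accounts for the mass by which the image of
    \<open>\<mu>\<close> may fall short of \<open>\<rho>\<close>.\<close>
  define T where "T p = {t. 0 < t \<and> t < 1 \<and> 0 < Q p t}" for p
  define q where "q p = distr (density lborel (indicator (T p))) X (\<lambda>t. d (Q p t))" for p
  have Qp: "Q p \<in> borel_measurable borel" if "p \<in> space (Z \<Otimes>\<^sub>M Y)" for p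
    using measurable_Pair2[OF Q that] by simp
  have q_emeasure: "emeasure (q p) U = (\<integral>\<^sup>+ t. indicator (T p) t * indicator U (d (Q p t)) \<partial>lborel)"
    if p: "p \<in> space (Z \<Otimes>\<^sub>M Y)" and U: "U \<in> sets X" for p U
  proof -
    note [measurable] = Qp[OF p]
    have [measurable]: "T p \<in> sets borel" unfolding T_def by measurable
    have [measurable]: "(\<lambda>t. d (Q p t)) -` U \<in> sets borel"
      using measurable_sets[OF measurable_compose[OF Qp[OF p] d] U] by simp
    show ?thesis
      using U unfolding q_def
      by (subst emeasure_distr) (auto simp: emeasure_density intro!: nn_integral_cong split: split_indicator)
  qed
  have T [measurable]: "(\<lambda>w. indicator (T (fst w)) (snd w) :: ennreal) \<in> borel_measurable ((Z \<Otimes>\<^sub>M Y) \<Otimes>\<^sub>M borel)"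
    using Q unfolding T_def indicator_def by (simp add: case_prod_beta)
  have Q' [measurable]: "(\<lambda>w. Q (fst w) (snd w)) \<in> borel_measurable ((Z \<Otimes>\<^sub>M Y) \<Otimes>\<^sub>M borel)"
    using Q by (simp add: case_prod_beta)
  have q: "q \<in> Z \<Otimes>\<^sub>M Y \<rightarrow>\<^sub>M subprob_algebra X"
  proof (rule measurable_subprob_algebra)
    fix p assume p: "p \<in> space (Z \<Otimes>\<^sub>M Y)"
    show "sets (q p) = sets X" by (simp add: q_def)
    show "subprob_space (q p)"
    proof (rule subprob_spaceI)
      have "emeasure (q p) (space (q p)) = (\<integral>\<^sup>+ t. indicator (T p) t * indicator (space X) (d (Q p t)) \<partial>lborel)"
        using q_emeasure[OF p sets.top] by (simp add: q_def)
      also have "\<dots> \<le> (\<integral>\<^sup>+ t. indicator {0<..<1} t \<partial>(lborel :: real measure))"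
        by (intro nn_integral_mono) (auto simp: T_def split: split_indicator)
      finally show "emeasure (q p) (space (q p)) \<le> 1" by simp
    qed (simp add: q_def X_ne)
  next
    fix U assume [measurable]: "U \<in> sets X"
    have "(\<lambda>p. \<integral>\<^sup>+ t. indicator (T p) t * indicator U (d (Q p t)) \<partial>lborel) \<in> borel_measurable (Z \<Otimes>\<^sub>M Y)"
      by (intro lborel.borel_measurable_nn_integral) (simp add: case_prod_beta)
    then show "(\<lambda>p. emeasure (q p) U) \<in> borel_measurable (Z \<Otimes>\<^sub>M Y)"
      by (subst measurable_cong[OF q_emeasure]) auto
  qed
  show thesis
  proof (rule that[OF q])
    fix z U V assume z: "z \<in> space Z" and U [measurable]: "U \<in> sets X" and V [measurable]: "V \<in> sets Y"
    note sets_mu [measurable_cong, simp] = sets_kernel[OF mu z]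
    note sets_rho [measurable_cong, simp] = sets_kernel[OF rho z]
    note [simp] = sets_eq_imp_space_eq[OF sets_mu] sets_eq_imp_space_eq[OF sets_rho]
    interpret mu: subprob_space "\<mu> z" by (rule subprob_space_kernel[OF mu z])
    interpret rho: subprob_space "\<rho> z" by (rule subprob_space_kernel[OF rho z])
    have Fz [measurable]: "(\<lambda>y. F c (z, y)) \<in> borel_measurable Y" for c
      using z by (rule measurable_Pair2[OF F])
    have zp: "(z, y) \<in> space (Z \<Otimes>\<^sub>M Y)" if "y \<in> space Y" for y
      using z that by (simp add: space_pair_measure)
    have F_int: "(\<integral>\<^sup>+ y\<in>V. F c (z, y) \<partial>\<rho> z) = emeasure (\<mu> z) ({x \<in> space X. c < e x} \<inter> (\<phi> -` V \<inter> space X))" for c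
      using K_emeasure[OF z V, of c] by (simp add: KF[OF z] emeasure_density)
    have F_le_1: "AE y in \<rho> z. F c (z, y) \<le> 1" for c
      using K_le[OF z, of _ c] unfolding KF[OF z]
      by (intro AE_le_of_density_le) (auto simp: density_1 rho.emeasure_finite less_top[symmetric])
    have F_mono: "AE y in \<rho> z. F c' (z, y) \<le> F c (z, y)" if "c \<le> c'" for c c'
    proof (rule AE_le_of_density_le)
      show "emeasure (density (\<rho> z) (\<lambda>y. F c (z, y))) (space (\<rho> z)) < \<infinity>"
        using K_le[OF z sets.top, of c] rho.emeasure_finite[of "space Y"] by (auto simp: KF[OF z] top_unique less_top[symmetric])
      fix A assume "A \<in> sets (\<rho> z)"
      then show "emeasure (density (\<rho> z) (\<lambda>y. F c' (z, y))) A \<le> emeasure (density (\<rho> z) (\<lambda>y. F c (z, y))) A"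
        using that by (auto simp flip: KF[OF z] simp: K_emeasure[OF z] intro!: emeasure_mono)
    qed auto
    have tail: "(\<integral>\<^sup>+ y\<in>V. min 1 (SUP c\<in>{c \<in> C. x < c}. F c (z, y)) \<partial>\<rho> z) =
        emeasure (\<mu> z) ({w \<in> space X. x < e w} \<inter> (\<phi> -` V \<inter> space X))" if x: "0 \<le> x" for x
    proof (rule antisym)
      \<comment> \<open>\<open>F x\<close> is available for every real level \<open>x\<close>, not
        only for those in \<open>C\<close>, and bounds the supremum from above.\<close>
      have "AE y in \<rho> z. \<forall>c\<in>{c \<in> C. x < c}. F c (z, y) \<le> F x (z, y)"
        using C F_mono by (intro AE_ball_countable') auto
      then have "(\<integral>\<^sup>+ y\<in>V. min 1 (SUP c\<in>{c \<in> C. x < c}. F c (z, y)) \<partial>\<rho> z) \<le> (\<integral>\<^sup>+ y\<in>V. F x (z, y) \<partial>\<rho> z)"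
        by (intro nn_integral_mono_AE) (auto intro!: mult_right_mono min.coboundedI2 SUP_least elim!: eventually_mono)
      then show "(\<integral>\<^sup>+ y\<in>V. min 1 (SUP c\<in>{c \<in> C. x < c}. F c (z, y)) \<partial>\<rho> z) \<le>
          emeasure (\<mu> z) ({w \<in> space X. x < e w} \<inter> (\<phi> -` V \<inter> space X))"
        by (simp add: F_int)
    next
      define A where "A n = {w \<in> space X. x + inverse (real (Suc n)) < e w} \<inter> (\<phi> -` V \<inter> space X)" for n
      have A_eq: "{w \<in> space X. x < e w} \<inter> (\<phi> -` V \<inter> space X) = (\<Union>n. A n)"
      proof (intro equalityI subsetI)
        fix w assume w: "w \<in> {w \<in> space X. x < e w} \<inter> (\<phi> -` V \<inter> space X)"
        then obtain n where "inverse (real (Suc n)) < e w - x"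
          using reals_Archimedean[of "e w - x"] by auto
        then show "w \<in> (\<Union>n. A n)" using w by (auto simp: A_def intro!: exI[of _ n])
      next
        fix w assume "w \<in> (\<Union>n. A n)"
        then obtain n where n: "x + inverse (real (Suc n)) < e w" and w: "w \<in> \<phi> -` V \<inter> space X"
          unfolding A_def by blast
        have "0 < inverse (real (Suc n))" by simp
        with n have "x < e w" by linarith
        with w show "w \<in> {w \<in> space X. x < e w} \<inter> (\<phi> -` V \<inter> space X)" by auto
      qed
      have inc: "incseq A"
        unfolding A_def incseq_def
        by (auto intro: le_less_trans[rotated] intro!: le_imp_inverse_le add_left_mono)
      have [measurable]: "A n \<in> sets X" for n unfolding A_def by measurable
      \<comment> \<open>A rational level strictly between \<open>x\<close> and
        \<open>x + inverse (real (Suc n))\<close>, and below 1 so as to lie in \<open>C\<close>,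
        gives the bound. For \<open>x\<close> at least 1 there is no such level, but then
        \<open>A n\<close> is empty because \<open>e\<close> stays below 1.\<close>
      have "emeasure (\<mu> z) (A n) \<le> (\<integral>\<^sup>+ y\<in>V. min 1 (SUP c\<in>{c \<in> C. x < c}. F c (z, y)) \<partial>\<rho> z)" for n
      proof (cases "x < 1")
        case False
        have "\<not> x + inverse (real (Suc n)) < e w" if "w \<in> space X" for w
        proof -
          have "0 < inverse (real (Suc n))" by simp
          with False e01(2)[OF that] show ?thesis by linarith
        qed
        then have "A n = {}" unfolding A_def by blast
        then show ?thesis by simp
      next
        case True
        obtain c where c: "c \<in> \<rat>" "x < c" "c < min 1 (x + inverse (real (Suc n)))"
          using Rats_dense_in_real[of x "min 1 (x + inverse (real (Suc n)))"] True by auto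
        then have cC: "c \<in> {c \<in> C. x < c}" using x by (auto simp: C_def)
        have "emeasure (\<mu> z) (A n) \<le> emeasure (\<mu> z) ({w \<in> space X. c < e w} \<inter> (\<phi> -` V \<inter> space X))"
          using c by (intro emeasure_mono) (auto simp: A_def)
        also have "\<dots> = (\<integral>\<^sup>+ y\<in>V. F c (z, y) \<partial>\<rho> z)" by (simp add: F_int)
        also have "\<dots> \<le> (\<integral>\<^sup>+ y\<in>V. min 1 (SUP c\<in>{c \<in> C. x < c}. F c (z, y)) \<partial>\<rho> z)"
          using F_le_1[of c] cC
          by (intro nn_integral_mono_AE) (auto intro!: mult_right_mono SUP_upper2[of c] elim!: eventually_mono)
        finally show ?thesis .
      qed
      then have "(SUP n. emeasure (\<mu> z) (A n)) \<le> (\<integral>\<^sup>+ y\<in>V. min 1 (SUP c\<in>{c \<in> C. x < c}. F c (z, y)) \<partial>\<rho> z)"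
        by (intro SUP_least)
      then show "emeasure (\<mu> z) ({w \<in> space X. x < e w} \<inter> (\<phi> -` V \<inter> space X)) \<le>
          (\<integral>\<^sup>+ y\<in>V. min 1 (SUP c\<in>{c \<in> C. x < c}. F c (z, y)) \<partial>\<rho> z)"
        unfolding A_eq using inc by (subst SUP_emeasure_incseq[symmetric]) auto
    qed
    have Qz: "(\<lambda>w. Q (z, fst w) (snd w)) \<in> borel_measurable (\<rho> z \<Otimes>\<^sub>M lborel)"
    proof -
      have "(\<lambda>w. ((z, fst w), snd w)) \<in> \<rho> z \<Otimes>\<^sub>M lborel \<rightarrow>\<^sub>M (Z \<Otimes>\<^sub>M Y) \<Otimes>\<^sub>M borel"
        using z by measurable
      from measurable_compose[OF this Q] show ?thesis by simp
    qed
    note [measurable] = Qz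
    define H where "H = {w \<in> space (\<rho> z \<Otimes>\<^sub>M lborel). fst w \<in> V \<and> 0 < snd w \<and> snd w < 1 \<and> 0 < Q (z, fst w) (snd w)}"
    have [measurable]: "H \<in> sets (\<rho> z \<Otimes>\<^sub>M lborel)"
      unfolding H_def by measurable
    \<comment> \<open>Both sides of the claim become finite measures on the line of codes, so
      half-lines suffice to compare them. The set \<open>U\<close> enters only at the end, through
      its preimage under \<open>d\<close>.\<close>
    define M1 where "M1 = distr (density (\<rho> z \<Otimes>\<^sub>M lborel) (indicator H)) borel (\<lambda>w. Q (z, fst w) (snd w))"
    define M2 where "M2 = distr (density (\<mu> z) (indicator (\<phi> -` V \<inter> space X))) borel e"
    have M1: "emeasure M1 W = (\<integral>\<^sup>+ y\<in>V. (\<integral>\<^sup>+ t. indicator (T (z, y)) t * indicator W (Q (z, y) t) \<partial>lborel) \<partial>\<rho> z)"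
      if [measurable]: "W \<in> sets borel" for W
    proof -
      have "emeasure M1 W = (\<integral>\<^sup>+ w. indicator H w * indicator W (Q (z, fst w) (snd w)) \<partial>(\<rho> z \<Otimes>\<^sub>M lborel))"
        unfolding M1_def using measurable_sets[OF Qz that]
        by (subst emeasure_distr) (auto simp: emeasure_density intro!: nn_integral_cong split: split_indicator)
      also have "\<dots> = (\<integral>\<^sup>+ y. \<integral>\<^sup>+ t. indicator H (y, t) * indicator W (Q (z, y) t) \<partial>lborel \<partial>\<rho> z)"
        by (subst lborel.nn_integral_fst[symmetric]) auto
      also have "\<dots> = (\<integral>\<^sup>+ y\<in>V. (\<integral>\<^sup>+ t. indicator (T (z, y)) t * indicator W (Q (z, y) t) \<partial>lborel) \<partial>\<rho> z)"
        by (intro nn_integral_cong) (auto simp: H_def T_def space_pair_measure split: split_indicator intro!: nn_integral_cong)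
      finally show ?thesis .
    qed
    have M2: "emeasure M2 W = emeasure (\<mu> z) ((e -` W \<inter> space X) \<inter> (\<phi> -` V \<inter> space X))"
      if [measurable]: "W \<in> sets borel" for W
      unfolding M2_def by (subst emeasure_distr) (auto simp: emeasure_restricted Int_commute)
    have "M1 = M2"
    proof (rule measure_eqI_lessThan)
      fix x :: real
      \<comment> \<open>Both measures charge only positive codes, so a half-line starting below 0
        may as well start at 0, where \<open>tail\<close> applies.\<close>
      define x' where "x' = max x 0"
      have "(\<integral>\<^sup>+ t. indicator (T (z, y)) t * indicator {x<..} (Q (z, y) t) \<partial>lborel) =
          min 1 (SUP c\<in>{c \<in> C. x' < c}. F c (z, y))" if "y \<in> space Y" for y
      proof -
        note [measurable] = Qp[OF zp[OF that]]
        have "(\<integral>\<^sup>+ t. indicator (T (z, y)) t * indicator {x<..} (Q (z, y) t) \<partial>lborel) =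
            (\<integral>\<^sup>+ t. indicator {t. 0 < t \<and> t < 1 \<and> x' < Q (z, y) t} t \<partial>lborel)"
          by (intro nn_integral_cong) (auto simp: T_def x'_def split: split_indicator)
        also have "\<dots> = emeasure lborel {t. 0 < t \<and> t < 1 \<and> x' < Q (z, y) t}"
          by (subst nn_integral_indicator) auto
        also have "\<dots> = emeasure lborel {t. 0 < t \<and> t < 1 \<and> (\<exists>c\<in>{c \<in> C. x' < c}. ennreal t \<le> F c (z, y))}"
          by (subst Q_greater) (auto simp: x'_def)
        also have "\<dots> = min 1 (SUP c\<in>{c \<in> C. x' < c}. F c (z, y))"
          by (rule emeasure_unit_interval_hypograph)
        finally show ?thesis .
      qed
      then have "emeasure M1 {x<..} = (\<integral>\<^sup>+ y\<in>V. min 1 (SUP c\<in>{c \<in> C. x' < c}. F c (z, y)) \<partial>\<rho> z)"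
        by (subst M1) (auto intro!: nn_integral_cong)
      also have "\<dots> = emeasure (\<mu> z) ({w \<in> space X. x' < e w} \<inter> (\<phi> -` V \<inter> space X))"
        by (rule tail) (simp add: x'_def)
      also have "{w \<in> space X. x' < e w} = e -` {x<..} \<inter> space X"
        using e01(1) by (auto simp: x'_def)
      finally show eq: "emeasure M1 {x<..} = emeasure M2 {x<..}"
        by (simp add: M2)
      show "emeasure M1 {x<..} < \<infinity>"
        unfolding eq by (simp add: M2 mu.emeasure_finite less_top[symmetric])
    qed (simp_all add: M1_def M2_def)
    have dU [measurable]: "d -` U \<in> sets borel"
      using measurable_sets[OF d U] by simp
    have "(\<integral>\<^sup>+ y\<in>V. emeasure (q (z, y)) U \<partial>\<rho> z) = emeasure M1 (d -` U)"
      by (subst M1) (auto intro!: nn_integral_cong simp: q_emeasure[OF zp U] indicator_vimage)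
    also have "\<dots> = emeasure (\<mu> z) ((e -` (d -` U) \<inter> space X) \<inter> (\<phi> -` V \<inter> space X))"
      unfolding \<open>M1 = M2\<close> by (rule M2) measurable
    also have "(e -` (d -` U) \<inter> space X) \<inter> (\<phi> -` V \<inter> space X) = U \<inter> \<phi> -` V"
      using de sets.sets_into_space[OF U] by auto
    finally show "(\<integral>\<^sup>+ y\<in>V. emeasure (q (z, y)) U \<partial>\<rho> z) = emeasure (\<mu> z) (U \<inter> \<phi> -` V)" .
  qed
qed

section \<open>S-finite kernels and zero-infinity sets\<close>

lemma suminf_ennreal_swap:
  fixes f :: "nat \<Rightarrow> nat \<Rightarrow> ennreal"
  shows "(\<Sum>i. \<Sum>j. f i j) = (\<Sum>j. \<Sum>i. f i j)"
  using nn_integral_suminf[of "\<lambda>i j. f i j" "count_space UNIV"]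
  by (simp add: nn_integral_count_space_nat)

lemma le_suminf_ennreal:
  fixes f :: "nat \<Rightarrow> ennreal"
  shows "f i \<le> (\<Sum>i. f i)"
  using sum_le_suminf[of f "{i}"] by simp

definition measure_sum :: "'b measure \<Rightarrow> (nat \<Rightarrow> 'b measure) \<Rightarrow> 'b measure" where
  "measure_sum Y m = measure_of (space Y) (sets Y) (\<lambda>A. \<Sum>i. emeasure (m i) A)"

lemma sets_measure_sum [simp, measurable_cong]: "sets (measure_sum Y m) = sets Y"
  by (simp add: measure_sum_def)

lemma space_measure_sum [simp]: "space (measure_sum Y m) = space Y"
  by (simp add: measure_sum_def)

lemma emeasure_measure_sum:
  assumes sets: "\<And>i. sets (m i) = sets Y" and A: "A \<in> sets Y"
  shows "emeasure (measure_sum Y m) A = (\<Sum>i. emeasure (m i) A)"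
  unfolding measure_sum_def
proof (rule emeasure_measure_of_sigma)
  show "countably_additive (sets Y) (\<lambda>A. \<Sum>i. emeasure (m i) A)"
  proof (rule countably_additiveI)
    fix A :: "nat \<Rightarrow> 'a set" assume A: "range A \<subseteq> sets Y" "disjoint_family A"
    then show "(\<Sum>n. \<Sum>i. emeasure (m i) (A n)) = (\<Sum>i. emeasure (m i) (\<Union> (range A)))"
      by (subst suminf_ennreal_swap) (simp add: suminf_emeasure sets)
  qed
qed (simp_all add: sets.sigma_algebra_axioms positive_def A)

lemma measurable_measure_sum:
  assumes Y: "space Y \<noteq> {}"
    and m: "\<And>i. m i \<in> Z \<rightarrow>\<^sub>M subprob_algebra Y"
    and le: "\<And>i z. z \<in> space Z \<Longrightarrow> emeasure (m i z) (space Y) \<le> ennreal ((1 / 2) ^ Suc i)"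
  shows "(\<lambda>z. measure_sum Y (\<lambda>i. m i z)) \<in> Z \<rightarrow>\<^sub>M subprob_algebra Y"
proof (rule measurable_subprob_algebra)
  fix z assume z: "z \<in> space Z"
  show "subprob_space (measure_sum Y (\<lambda>i. m i z))"
  proof (rule subprob_spaceI)
    have "emeasure (measure_sum Y (\<lambda>i. m i z)) (space Y) = (\<Sum>i. emeasure (m i z) (space Y))"
      using sets_kernel[OF m z] by (simp add: emeasure_measure_sum)
    also have "\<dots> \<le> (\<Sum>i. ennreal ((1 / 2) ^ Suc i))"
      using le[OF z] by (intro suminf_le) auto
    also have "\<dots> = 1"
      using power_half_series by (subst suminf_ennreal2) (auto simp: sums_iff)
    finally show "emeasure (measure_sum Y (\<lambda>i. m i z)) (space (measure_sum Y (\<lambda>i. m i z))) \<le> 1" by simp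
  qed (simp add: Y)
next
  fix A assume A: "A \<in> sets Y"
  then have "emeasure (measure_sum Y (\<lambda>i. m i z)) A = (\<Sum>i. emeasure (m i z) A)" if "z \<in> space Z" for z
    using sets_kernel[OF m that] by (simp add: emeasure_measure_sum)
  then show "(\<lambda>z. emeasure (measure_sum Y (\<lambda>i. m i z)) A) \<in> borel_measurable Z"
    using measurable_emeasure_kernel[OF m A] by (subst measurable_cong) auto
qed simp

lemma finite_kernel_scale:
  assumes Y: "space Y \<noteq> {}" and k: "finite_kernel Z Y k" and \<epsilon>: "0 < \<epsilon>" "\<epsilon> \<le> 1"
  obtains c m where "(0::ennreal) < c" "c < \<infinity>" "m \<in> Z \<rightarrow>\<^sub>M subprob_algebra Y"
    "\<And>z. z \<in> space Z \<Longrightarrow> emeasure (m z) (space Y) \<le> ennreal \<epsilon>"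
    "\<And>z A. z \<in> space Z \<Longrightarrow> A \<in> sets Y \<Longrightarrow> emeasure (k z) A = c * emeasure (m z) A"
proof -
  obtain b where b: "(SUP x\<in>space Z. emeasure (k x) (space Y)) = ennreal b" "0 \<le> b"
    using k unfolding finite_kernel_def by (cases "SUP x\<in>space Z. emeasure (k x) (space Y)") auto
  have le_b: "emeasure (k z) (space Y) \<le> ennreal b" if "z \<in> space Z" for z
    using that unfolding b(1)[symmetric] by (rule SUP_upper)
  \<comment> \<open>The summand 1 keeps the denominator positive when the kernel vanishes.\<close>
  define a where "a = \<epsilon> / (1 + b)"
  have a: "0 < a" "a * b \<le> \<epsilon>"
    using b(2) \<epsilon> by (auto simp: a_def field_simps)
  have sets_k: "\<And>z. z \<in> space Z \<Longrightarrow> sets (k z) = sets Y"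
    and meas_k: "\<And>A. A \<in> sets Y \<Longrightarrow> (\<lambda>z. emeasure (k z) A) \<in> borel_measurable Z"
    using k by (auto simp: finite_kernel_def kernel_def)
  have bound: "emeasure (scale_measure (ennreal a) (k z)) (space Y) \<le> ennreal \<epsilon>" if z: "z \<in> space Z" for z
  proof -
    have "emeasure (scale_measure (ennreal a) (k z)) (space Y) \<le> ennreal a * ennreal b"
      using le_b[OF z] by (auto intro: mult_left_mono)
    also have "\<dots> \<le> ennreal \<epsilon>"
      using a b(2) by (simp add: ennreal_mult[symmetric] ennreal_leI)
    finally show ?thesis .
  qed
  show thesis
  proof (rule that[of "ennreal (inverse a)" "\<lambda>z. scale_measure (ennreal a) (k z)"])
    show "(\<lambda>z. scale_measure (ennreal a) (k z)) \<in> Z \<rightarrow>\<^sub>M subprob_algebra Y"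
    proof (rule measurable_subprob_algebra)
      fix z assume z: "z \<in> space Z"
      show "sets (scale_measure (ennreal a) (k z)) = sets Y" by (simp add: sets_k z)
      show "subprob_space (scale_measure (ennreal a) (k z))"
      proof (rule subprob_spaceI)
        have "ennreal \<epsilon> \<le> 1" using \<epsilon> by simp
        then show "emeasure (scale_measure (ennreal a) (k z)) (space (scale_measure (ennreal a) (k z))) \<le> 1"
          using order_trans[OF bound[OF z]] sets_eq_imp_space_eq[OF sets_k[OF z]] by (simp add: space_scale_measure)
      qed (use Y sets_eq_imp_space_eq[OF sets_k[OF z]] in \<open>simp add: space_scale_measure\<close>)
    qed (use meas_k in simp)
    show "emeasure (k z) A = ennreal (inverse a) * emeasure (scale_measure (ennreal a) (k z)) A" for z A
      using a by (simp add: mult.assoc[symmetric] ennreal_mult[symmetric])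
  qed (use a bound in auto)
qed

text \<open>The factors \<open>c i\<close> are kept apart so that the pieces can be summed without
  them to a finite kernel with the same null sets. The base 1/4 instead of 1/2 leaves room for
  interleaving two such families.\<close>

lemma s_finite_kernel_scale:
  assumes Y: "space Y \<noteq> {}" and k: "s_finite_kernel Z Y k"
  obtains c m where "\<And>i. (0::ennreal) < c i" "\<And>i. c i < \<infinity>" "\<And>i. m i \<in> Z \<rightarrow>\<^sub>M subprob_algebra Y"
    "\<And>i z. z \<in> space Z \<Longrightarrow> emeasure (m i z) (space Y) \<le> ennreal ((1 / 4) ^ Suc i)"
    "\<And>z A. z \<in> space Z \<Longrightarrow> A \<in> sets Y \<Longrightarrow> emeasure (k z) A = (\<Sum>i. c i * emeasure (m i z) A)"
proof -
  obtain ki where ki: "\<And>i. finite_kernel Z Y (ki i)"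
    and sums: "\<And>z A. z \<in> space Z \<Longrightarrow> A \<in> sets Y \<Longrightarrow> emeasure (k z) A = (\<Sum>i. emeasure (ki i z) A)"
    using k unfolding s_finite_kernel_def kernel_sums_def by blast
  have "\<exists>c m. (0::ennreal) < c \<and> c < \<infinity> \<and> m \<in> Z \<rightarrow>\<^sub>M subprob_algebra Y \<and>
    (\<forall>z\<in>space Z. emeasure (m z) (space Y) \<le> ennreal ((1 / 4) ^ Suc i)) \<and>
    (\<forall>z\<in>space Z. \<forall>A\<in>sets Y. emeasure (ki i z) A = c * emeasure (m z) A)" for i
    by (rule finite_kernel_scale[OF Y ki, of "(1 / 4) ^ Suc i" i]) (simp, rule power_le_one, simp_all, blast)
  then obtain c m where cm: "\<And>i. (0::ennreal) < c i" "\<And>i. c i < \<infinity>" "\<And>i. m i \<in> Z \<rightarrow>\<^sub>M subprob_algebra Y"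
    "\<And>i z. z \<in> space Z \<Longrightarrow> emeasure (m i z) (space Y) \<le> ennreal ((1 / 4) ^ Suc i)"
    "\<And>i z A. z \<in> space Z \<Longrightarrow> A \<in> sets Y \<Longrightarrow> emeasure (ki i z) A = c i * emeasure (m i z) A"
    by metis
  show thesis
    by (rule that[of c m]) (use cm sums in auto)
qed

text \<open>Densities of the pieces are added up. The sum may be infinite on a set of positive
  measure, and this is how a failure of sigma-finiteness becomes visible.\<close>

lemma kernel_density_of_dominating:
  assumes Y: "standard_borel Y" and m: "\<And>i. m i \<in> Z \<rightarrow>\<^sub>M subprob_algebra Y" and rho: "\<rho> \<in> Z \<rightarrow>\<^sub>M subprob_algebra Y"
    and le: "\<And>i z A. z \<in> space Z \<Longrightarrow> A \<in> sets Y \<Longrightarrow> emeasure (m i z) A \<le> emeasure (\<rho> z) A"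
    and k: "kernel Z Y k"
    and sums: "\<And>z A. z \<in> space Z \<Longrightarrow> A \<in> sets Y \<Longrightarrow> emeasure (k z) A = (\<Sum>i. c i * emeasure (m i z) A)"
  obtains h :: "'c \<times> 'b \<Rightarrow> ennreal" where "h \<in> borel_measurable (Z \<Otimes>\<^sub>M Y)"
    "\<And>z. z \<in> space Z \<Longrightarrow> k z = density (\<rho> z) (\<lambda>y. h (z, y))"
proof -
  have "\<exists>h. h \<in> borel_measurable (Z \<Otimes>\<^sub>M Y) \<and> (\<forall>z\<in>space Z. m i z = density (\<rho> z) (\<lambda>y. h (z, y)))" for i
    using dominated_kernel_density[OF Y m rho le, of i] by metis
  then obtain h where h [measurable]: "\<And>i. h i \<in> borel_measurable (Z \<Otimes>\<^sub>M Y)"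
    and mh: "\<And>i z. z \<in> space Z \<Longrightarrow> m i z = density (\<rho> z) (\<lambda>y. h i (z, y))"
    by metis
  show thesis
  proof (rule that[of "\<lambda>p. \<Sum>i. c i * h i p"])
    fix z assume z: "z \<in> space Z"
    note sets_rho [measurable_cong, simp] = sets_kernel[OF rho z]
    have sets_k: "sets (k z) = sets Y" using k z by (simp add: kernel_def)
    have [measurable]: "(\<lambda>y. h i (z, y)) \<in> borel_measurable Y" for i
      using z by (rule measurable_Pair2[OF h])
    show "k z = density (\<rho> z) (\<lambda>y. \<Sum>i. c i * h i (z, y))"
    proof (rule measure_eqI)
      fix A assume "A \<in> sets (k z)"
      then have A [measurable]: "A \<in> sets Y" by (simp add: sets_k)
      have "emeasure (k z) A = (\<Sum>i. \<integral>\<^sup>+ y. c i * (h i (z, y) * indicator A y) \<partial>\<rho> z)"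
        by (simp add: sums z A mh emeasure_density nn_integral_cmult)
      also have "\<dots> = (\<integral>\<^sup>+ y. (\<Sum>i. c i * h i (z, y)) * indicator A y \<partial>\<rho> z)"
        by (subst nn_integral_suminf[symmetric]) (auto simp: mult.assoc[symmetric])
      finally show "emeasure (k z) A = emeasure (density (\<rho> z) (\<lambda>y. \<Sum>i. c i * h i (z, y))) A"
        by (simp add: emeasure_density)
    qed (simp add: sets_k)
  qed measurable
qed

section \<open>Zero-infinity sets of a measure with a density\<close>

text \<open>Where \<open>h\<close> is infinite the measure is infinity times \<open>M\<close>.
  Elsewhere a 0-infinity set splits into the pieces with \<open>h\<close> at most \<open>n\<close>;
  these have finite measure because \<open>M\<close> is finite, hence measure 0.\<close>

lemma is_top_zero_infty_set_density:
  assumes "finite_measure M" and h [measurable]: "h \<in> borel_measurable M"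
  shows "is_top_zero_infty_set (density M h) {y \<in> space M. h y = \<infinity>}"
proof -
  interpret finite_measure M by fact
  let ?T = "{y \<in> space M. h y = \<infinity>}"
  have T: "zero_infty_set (density M h) ?T"
    unfolding zero_infty_set_def
  proof (intro conjI ballI impI)
    fix V assume "V \<in> sets (density M h)" and VT: "V \<subseteq> ?T"
    then have [measurable]: "V \<in> sets M" by simp
    have "emeasure (density M h) V = (\<integral>\<^sup>+ y. \<infinity> * indicator V y \<partial>M)"
      using VT by (subst emeasure_density) (auto intro!: nn_integral_cong split: split_indicator)
    also have "\<dots> = \<infinity> * emeasure M V" by (subst nn_integral_cmult_indicator) auto
    finally show "emeasure (density M h) V \<in> {0, \<infinity>}" by (simp add: ennreal_top_mult)
  qed simp
  moreover have "emeasure (density M h) (B - ?T) = 0" if B: "zero_infty_set (density M h) B" for B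
  proof -
    have B' [measurable]: "B \<in> sets M" using B by (simp add: zero_infty_set_def)
    define A where "A n = {y \<in> B. h y \<le> of_nat n}" for n :: nat
    have [measurable]: "A n \<in> sets M" for n
    proof -
      have "A n = B \<inter> {y \<in> space M. h y \<le> of_nat n}" using sets.sets_into_space[OF B'] by (auto simp: A_def)
      then show ?thesis by simp
    qed
    have "emeasure (density M h) (A n) = 0" for n
    proof -
      have "emeasure (density M h) (A n) \<le> (\<integral>\<^sup>+ y. of_nat n * indicator (A n) y \<partial>M)"
        by (subst emeasure_density) (auto simp: A_def intro!: nn_integral_mono split: split_indicator)
      also have "\<dots> < \<infinity>"
        using emeasure_finite[of "A n", unfolded less_top]
        by (subst nn_integral_cmult_indicator) (auto simp: ennreal_mult_less_top of_nat_less_top)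
      finally show ?thesis
        using B unfolding zero_infty_set_def by (auto simp: A_def dest!: bspec[of _ _ "A n"])
    qed
    moreover have "B - ?T = (\<Union>n. A n)"
    proof -
      have "\<exists>n. h y \<le> of_nat n" if "h y \<noteq> \<infinity>" for y
        using ennreal_Ex_less_of_nat[of "h y"] that by (auto simp: less_top intro: less_imp_le)
      then show ?thesis using sets.sets_into_space[OF B'] by (auto simp: A_def top_unique)
    qed
    moreover have "range A \<subseteq> sets (density M h)" by auto
    ultimately show ?thesis using emeasure_UN_eq_0[of "density M h" A] by simp
  qed
  ultimately show ?thesis unfolding is_top_zero_infty_set_def by blast
qed

lemma is_top_top_zero_infty_set: "is_top_zero_infty_set m A \<Longrightarrow> is_top_zero_infty_set m (top_zero_infty_set m)"
  unfolding top_zero_infty_set_def by (rule someI)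

lemma s_finite_kernel_density:
  assumes Y: "standard_borel Y" and k: "s_finite_kernel Z Y k" and z: "z \<in> space Z"
  obtains M h where "finite_measure M" "h \<in> borel_measurable M" "k z = density M h"
proof -
  have Y_ne: "space Y \<noteq> {}" using Y by (simp add: standard_borel_def)
  obtain c m where cm: "\<And>i. (0::ennreal) < c i" "\<And>i. c i < \<infinity>" "\<And>i. m i \<in> Z \<rightarrow>\<^sub>M subprob_algebra Y"
    "\<And>i z. z \<in> space Z \<Longrightarrow> emeasure (m i z) (space Y) \<le> ennreal ((1 / 4) ^ Suc i)"
    "\<And>z A. z \<in> space Z \<Longrightarrow> A \<in> sets Y \<Longrightarrow> emeasure (k z) A = (\<Sum>i. c i * emeasure (m i z) A)"
    by (rule s_finite_kernel_scale[OF Y_ne k]) blast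
  have le: "emeasure (m i z) (space Y) \<le> ennreal ((1 / 2) ^ Suc i)" if "z \<in> space Z" for i z
    by (rule order_trans[OF cm(4)[OF that] ennreal_leI[OF power_mono]]) auto
  let ?\<rho> = "\<lambda>z. measure_sum Y (\<lambda>i. m i z)"
  have rho: "?\<rho> \<in> Z \<rightarrow>\<^sub>M subprob_algebra Y"
    by (rule measurable_measure_sum[OF Y_ne cm(3) le])
  have kernel: "kernel Z Y k" using k by (simp add: s_finite_kernel_def)
  obtain h where h: "h \<in> borel_measurable (Z \<Otimes>\<^sub>M Y)" "\<And>z. z \<in> space Z \<Longrightarrow> k z = density (?\<rho> z) (\<lambda>y. h (z, y))"
  proof (rule kernel_density_of_dominating[OF Y cm(3) rho _ kernel cm(5)])
    show "emeasure (m i z) A \<le> emeasure (?\<rho> z) A" if "z \<in> space Z" "A \<in> sets Y" for i z A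
      using that sets_kernel[OF cm(3)] le_suminf_ennreal[of "\<lambda>i. emeasure (m i z) A" i]
      by (simp add: emeasure_measure_sum)
  qed blast+
  show thesis
  proof (rule that[of "?\<rho> z" "\<lambda>y. h (z, y)"])
    show "finite_measure (?\<rho> z)" using subprob_space_kernel[OF rho z] by (simp add: subprob_space_def)
    show "(\<lambda>y. h (z, y)) \<in> borel_measurable (?\<rho> z)" using measurable_Pair2[OF h(1) z] by simp
    show "k z = density (?\<rho> z) (\<lambda>y. h (z, y))" by (rule h(2)[OF z])
  qed
qed

lemma s_finite_kernel_top_zero_infty_set:
  assumes "standard_borel Y" "s_finite_kernel Z Y k" "z \<in> space Z"
  shows "is_top_zero_infty_set (k z) (top_zero_infty_set (k z))"
  by (rule s_finite_kernel_density[OF assms]) (metis is_top_zero_infty_set_density is_top_top_zero_infty_set)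

text \<open>The set where the density is infinite is a 0-infinity set, hence null, and an almost
  everywhere finite density over a finite measure gives a sigma-finite one.\<close>

lemma s_finite_kernel_imp_sigma_finite_measure:
  assumes "standard_borel Y" "s_finite_kernel Z Y k" "z \<in> space Z"
    and null: "\<And>B. zero_infty_set (k z) B \<Longrightarrow> emeasure (k z) B = 0"
  shows "sigma_finite_measure (k z)"
proof (rule s_finite_kernel_density[OF assms(1-3)])
  fix M h assume M: "finite_measure M" and h [measurable]: "h \<in> borel_measurable M" and k: "k z = density M h"
  interpret finite_measure M by fact
  let ?T = "{y \<in> space M. h y = \<infinity>}"
  have "zero_infty_set (density M h) ?T"
    using is_top_zero_infty_set_density[OF M h] by (simp add: is_top_zero_infty_set_def)
  then have "emeasure (density M h) ?T = 0" using null by (simp add: k)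
  then have "AE y in M. h y * indicator ?T y = 0"
    by (simp add: emeasure_density nn_integral_0_iff_AE)
  then have "AE y in M. h y \<noteq> \<infinity>"
    using AE_space by eventually_elim auto
  then show ?thesis by (simp add: k sigma_finite_iff_density_finite)
qed

lemma finite_kernel_imp_s_finite:
  assumes "finite_kernel Z X k"
  shows "s_finite_kernel Z X k"
proof -
  define ki where "ki i = (if i = 0 then k else (\<lambda>_. null_measure X))" for i :: nat
  have "finite_kernel Z X (ki i)" for i
    using assms by (auto simp: ki_def finite_kernel_def kernel_def image_constant_conv)
  moreover have "emeasure (k x) V = (\<Sum>i. emeasure (ki i x) V)" for x V
    by (subst suminf_finite[of "{0}"]) (auto simp: ki_def)
  ultimately show ?thesis
    using assms unfolding s_finite_kernel_def kernel_sums_def finite_kernel_def by blast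
qed

text \<open>Each summand is cut into the pieces on which its total mass lies between consecutive integers.\<close>

lemma s_finite_kernelI:
  assumes k: "kernel Z X k" and ki: "\<And>i. kernel Z X (ki i)"
    and fin: "\<And>i z. z \<in> space Z \<Longrightarrow> emeasure (ki i z) (space X) < \<infinity>"
    and sums: "\<And>z U. z \<in> space Z \<Longrightarrow> U \<in> sets X \<Longrightarrow> emeasure (k z) U = (\<Sum>i. emeasure (ki i z) U)"
  shows "s_finite_kernel Z X k"
proof -
  \<comment> \<open>A finite kernel needs a bound uniform over the source, whereas
    \<open>fin\<close> is pointwise. On \<open>S i n\<close> the total mass is below
    \<open>Suc n\<close>.\<close>
  define S where "S i n = {z \<in> space Z. of_nat n \<le> emeasure (ki i z) (space X) \<and> emeasure (ki i z) (space X) < of_nat (Suc n)}"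
    for i n :: nat
  have [measurable]: "(\<lambda>z. emeasure (ki i z) U) \<in> borel_measurable Z" if "U \<in> sets X" for i U
    using ki that by (simp add: kernel_def)
  have [measurable]: "S i n \<in> sets Z" for i n unfolding S_def by measurable
  define kin where "kin i n z = (if z \<in> S i n then ki i z else null_measure X)" for i n z
  define l where "l j = (case prod_decode j of (i, n) \<Rightarrow> kin i n)" for j
  have kin: "finite_kernel Z X (kin i n)" for i n
    unfolding finite_kernel_def
  proof
    have "(\<lambda>z. emeasure (kin i n z) V) \<in> borel_measurable Z" if [measurable]: "V \<in> sets X" for V
    proof -
      have "(\<lambda>z. emeasure (kin i n z) V) = (\<lambda>z. if z \<in> S i n then emeasure (ki i z) V else 0)"
        by (auto simp: kin_def)
      also have "\<dots> \<in> borel_measurable Z" by measurable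
      finally show ?thesis .
    qed
    then show "kernel Z X (kin i n)"
      using ki by (auto simp: kernel_def kin_def)
    have "(SUP z\<in>space Z. emeasure (kin i n z) (space X)) \<le> of_nat (Suc n)"
      by (rule SUP_least) (auto simp: kin_def S_def)
    also have "\<dots> < (\<infinity> :: ennreal)" using of_nat_less_top by simp
    finally show "(SUP z\<in>space Z. emeasure (kin i n z) (space X)) < \<infinity>" .
  qed
  have piece: "emeasure (ki i z) U = (\<Sum>n. emeasure (kin i n z) U)" if z: "z \<in> space Z" for i z U
  proof -
    obtain r where r: "emeasure (ki i z) (space X) = ennreal r" "0 \<le> r"
      using fin[OF z, of i] by (cases "emeasure (ki i z) (space X)") auto
    have S: "z \<in> S i n \<longleftrightarrow> n = nat \<lfloor>r\<rfloor>" for n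
    proof -
      have "z \<in> S i n \<longleftrightarrow> ennreal (real n) \<le> ennreal r \<and> ennreal r < ennreal (real (Suc n))"
        by (simp only: S_def mem_Collect_eq r(1) ennreal_of_nat_eq_real_of_nat z simp_thms)
      also have "\<dots> \<longleftrightarrow> real n \<le> r \<and> r < real (Suc n)"
        using r(2) by (simp add: ennreal_less_iff del: of_nat_Suc)
      also have "\<dots> \<longleftrightarrow> n = nat \<lfloor>r\<rfloor>"
        using r(2) by (auto simp: of_nat_nat le_nat_iff nat_less_iff) linarith+
      finally show ?thesis .
    qed
    have "(\<Sum>n. emeasure (kin i n z) U) = (\<Sum>n\<in>{nat \<lfloor>r\<rfloor>}. emeasure (kin i n z) U)"
      by (rule suminf_finite) (auto simp: kin_def S)
    then show ?thesis by (simp add: kin_def S)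
  qed
  have "emeasure (k z) U = (\<Sum>j. emeasure (l j z) U)" if "z \<in> space Z" "U \<in> sets X" for z U
  proof -
    have "(\<Sum>j. emeasure (l j z) U) = (\<Sum>i. emeasure (ki i z) U)"
      using suminf_ennreal_2dimen[of "\<lambda>i. emeasure (ki i z) U" "\<lambda>(i, n). emeasure (kin i n z) U"] piece[OF that(1)]
      by (simp add: l_def case_prod_beta)
    then show ?thesis using sums[OF that] by simp
  qed
  moreover have "finite_kernel Z X (l j)" for j
    using kin by (simp add: l_def case_prod_beta)
  ultimately show ?thesis
    using k unfolding s_finite_kernel_def kernel_sums_def by blast
qed

text \<open>Countably many sets separate the points of the base, so that fibrewise concentration
  follows from the vanishing of countably many integrals.\<close>

lemma AE_fibre_null:
  assumes Y: "standard_borel Y" and phi [measurable]: "\<phi> \<in> X \<rightarrow>\<^sub>M Y" and sets_M [simp, measurable_cong]: "sets M = sets Y"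
    and k: "kernel Y X k"
    and null: "\<And>V. V \<in> sets Y \<Longrightarrow> (\<integral>\<^sup>+ y\<in>V. emeasure (k y) (space X - \<phi> -` V) \<partial>M) = 0"
  shows "AE y in M. emeasure (k y) (space X - \<phi> -` {y}) = 0"
proof -
  obtain e d where e [measurable]: "e \<in> Y \<rightarrow>\<^sub>M (borel :: real measure)"
    and de: "\<And>y. y \<in> space Y \<Longrightarrow> d (e y) = y"
    using standard_borel_retract[OF Y] by metis
  have space_M [simp]: "space M = space Y" by (rule sets_eq_imp_space_eq) simp
  define V where "V c = e -` {fst c<..<snd c} \<inter> space Y" for c :: "real \<times> real"
  have [measurable]: "V c \<in> sets Y" for c unfolding V_def by measurable
  have compl: "space X - \<phi> -` V c \<in> sets X" for c
  proof -
    have "space X - \<phi> -` V c = space X - (\<phi> -` V c \<inter> space X)" by auto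
    then show ?thesis by simp
  qed
  have "AE y in M. emeasure (k y) (space X - \<phi> -` V c) * indicator (V c) y = 0" for c
  proof -
    have [measurable]: "(\<lambda>y. emeasure (k y) (space X - \<phi> -` V c)) \<in> borel_measurable Y"
      using k compl by (simp add: kernel_def)
    show ?thesis by (subst nn_integral_0_iff_AE[symmetric]) (auto intro: null)
  qed
  then have "AE y in M. \<forall>c\<in>\<rat> \<times> \<rat>. emeasure (k y) (space X - \<phi> -` V c) * indicator (V c) y = 0"
    by (intro AE_ball_countable') (auto simp: countable_rat)
  then show ?thesis
    using AE_space
  proof eventually_elim
    case (elim y)
    then have y: "y \<in> space Y" by simp
    let ?C = "{c \<in> \<rat> \<times> \<rat>. y \<in> V c}"
    have "space X - \<phi> -` {y} = (\<Union>c\<in>?C. space X - \<phi> -` V c)"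
    proof (intro equalityI subsetI)
      fix x assume x: "x \<in> space X - \<phi> -` {y}"
      then have phx: "\<phi> x \<in> space Y" using measurable_space[OF phi] by auto
      then have "e (\<phi> x) \<noteq> e y" using x y de by (metis DiffD2 singletonI vimageI)
      then obtain a b where "a \<in> \<rat>" "b \<in> \<rat>" "a < e y" "e y < b" "\<not> (a < e (\<phi> x) \<and> e (\<phi> x) < b)"
      proof (cases "e (\<phi> x) < e y")
        case True
        obtain a where "a \<in> \<rat>" "e (\<phi> x) < a" "a < e y" using Rats_dense_in_real[OF True] by auto
        moreover obtain b where "b \<in> \<rat>" "e y < b" using Rats_dense_in_real[of "e y" "e y + 1"] by auto
        ultimately show ?thesis using that[of a b] by simp
      next
        case False
        then have "e y < e (\<phi> x)" using \<open>e (\<phi> x) \<noteq> e y\<close> by simp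
        from Rats_dense_in_real[OF this] obtain b where "b \<in> \<rat>" "b < e (\<phi> x)" "e y < b" by auto
        moreover obtain a where "a \<in> \<rat>" "a < e y" using Rats_dense_in_real[of "e y - 1" "e y"] by auto
        ultimately show ?thesis using that[of a b] by simp
      qed
      then show "x \<in> (\<Union>c\<in>?C. space X - \<phi> -` V c)"
        using x y phx by (intro UN_I[of "(a, b)"]) (auto simp: V_def)
    qed auto
    moreover have "(\<Union>c\<in>?C. space X - \<phi> -` V c) \<in> null_sets (k y)"
    proof (rule null_sets_UN')
      show "countable ?C" using countable_rat by (intro countable_Collect countable_SIGMA) auto
      fix c assume "c \<in> ?C"
      then have "c \<in> \<rat> \<times> \<rat>" and "y \<in> V c" by blast+
      from bspec[OF elim(1) this(1)] this(2) have "emeasure (k y) (space X - \<phi> -` V c) = 0" by simp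
      moreover have "sets (k y) = sets X" using k y by (simp add: kernel_def)
      ultimately show "space X - \<phi> -` V c \<in> null_sets (k y)" using compl by (intro null_setsI) auto
    qed
    ultimately show ?case by (simp only: null_setsD1)
  qed
qed

section \<open>Disintegration of s-finite kernels\<close>

text \<open>The sum of both families, taken alternately. The last conclusion, that
  \<open>\<rho>\<close> charges nothing beyond the pieces, later makes the density of
  \<open>\<nu>\<close> positive almost everywhere.\<close>

lemma interleaved_kernels_dominating:
  assumes Y: "space Y \<noteq> {}"
    and m: "\<And>i. m i \<in> Z \<rightarrow>\<^sub>M subprob_algebra Y" and n: "\<And>i. n i \<in> Z \<rightarrow>\<^sub>M subprob_algebra Y"
    and m_le: "\<And>i z. z \<in> space Z \<Longrightarrow> emeasure (m i z) (space Y) \<le> ennreal ((1 / 4) ^ Suc i)"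
    and n_le: "\<And>i z. z \<in> space Z \<Longrightarrow> emeasure (n i z) (space Y) \<le> ennreal ((1 / 4) ^ Suc i)"
  obtains \<rho> where "\<rho> \<in> Z \<rightarrow>\<^sub>M subprob_algebra Y"
    "\<And>i z A. z \<in> space Z \<Longrightarrow> A \<in> sets Y \<Longrightarrow> emeasure (m i z) A \<le> emeasure (\<rho> z) A"
    "\<And>i z A. z \<in> space Z \<Longrightarrow> A \<in> sets Y \<Longrightarrow> emeasure (n i z) A \<le> emeasure (\<rho> z) A"
    "\<And>z A. z \<in> space Z \<Longrightarrow> A \<in> sets Y \<Longrightarrow> (\<And>i. emeasure (m i z) A = 0) \<Longrightarrow> (\<And>i. emeasure (n i z) A = 0) \<Longrightarrow>
      emeasure (\<rho> z) A = 0"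
proof -
  define l where "l i = (if even i then m (i div 2) else n (i div 2))" for i
  define \<rho> where "\<rho> z = measure_sum Y (\<lambda>i. l i z)" for z
  have l: "l i \<in> Z \<rightarrow>\<^sub>M subprob_algebra Y" for i using m n by (simp add: l_def)
  have \<rho>: "emeasure (\<rho> z) A = (\<Sum>i. emeasure (l i z) A)" if "z \<in> space Z" "A \<in> sets Y" for z A
    unfolding \<rho>_def using that sets_kernel[OF l] by (simp add: emeasure_measure_sum)
  show thesis
  proof (rule that[of \<rho>])
    show "\<rho> \<in> Z \<rightarrow>\<^sub>M subprob_algebra Y"
      unfolding \<rho>_def
    proof (rule measurable_measure_sum[OF Y l])
      fix i z assume z: "z \<in> space Z"
      \<comment> \<open>Summand \<open>i\<close> has index \<open>i div 2\<close> in its own family,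
        and \<open>2 * Suc (i div 2)\<close> is at least \<open>Suc i\<close>, so the total mass is
        still at most 1.\<close>
      have "(1 / 4 :: real) ^ Suc (i div 2) = (1 / 2) ^ (2 * Suc (i div 2))"
        by (simp add: power_mult power2_eq_square)
      also have "\<dots> \<le> (1 / 2) ^ Suc i"
        by (rule power_decreasing) auto
      finally have le: "ennreal ((1 / 4) ^ Suc (i div 2)) \<le> ennreal ((1 / 2) ^ Suc i)" by (rule ennreal_leI)
      show "emeasure (l i z) (space Y) \<le> ennreal ((1 / 2) ^ Suc i)"
        using order_trans[OF m_le[OF z] le] order_trans[OF n_le[OF z] le] by (simp add: l_def)
    qed
    show "emeasure (m i z) A \<le> emeasure (\<rho> z) A" if "z \<in> space Z" "A \<in> sets Y" for i z A
      using le_suminf_ennreal[of "\<lambda>i. emeasure (l i z) A" "2 * i"] \<rho>[OF that] by (simp add: l_def)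
    show "emeasure (n i z) A \<le> emeasure (\<rho> z) A" if "z \<in> space Z" "A \<in> sets Y" for i z A
      using le_suminf_ennreal[of "\<lambda>i. emeasure (l i z) A" "Suc (2 * i)"] \<rho>[OF that] by (simp add: l_def)
    show "emeasure (\<rho> z) A = 0" if "z \<in> space Z" "A \<in> sets Y" "\<And>i. emeasure (m i z) A = 0" "\<And>i. emeasure (n i z) A = 0" for z A
    proof -
      have "emeasure (l i z) A = 0" for i using that(3,4) by (cases "even i") (simp_all add: l_def)
      then show ?thesis using \<rho>[OF that(1,2)] by simp
    qed
  qed
qed

text \<open>With \<open>\<rho>\<close> dominating \<open>\<nu>\<close> and \<open>\<phi>\<^sub>*\<mu>\<close>, write \<open>\<nu> = h \<rho>\<close> and let \<open>q i\<close> disintegrate the finite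
  pieces \<open>m i\<close> of \<open>\<mu>\<close> with respect to \<open>\<rho>\<close>. Dividing by \<open>h\<close> settles the part where \<open>h < \<infinity>\<close>.
  On \<open>h = \<infinity>\<close> nothing is divided: there \<open>\<mu>\<close> takes only the values \<open>0\<close> and \<open>\<infinity>\<close>, hence is
  unaffected by the factor \<open>\<infinity>\<close>.\<close>

lemma s_finite_disintegration:
  assumes X: "standard_borel X" and Y: "standard_borel Y"
    and mu: "s_finite_kernel Z X \<mu>" and nu: "s_finite_kernel Z Y \<nu>"
    and phi [measurable]: "\<phi> \<in> X \<rightarrow>\<^sub>M Y"
    and ac: "abs_cont_kernel Z (pushforward_kernel Y \<phi> \<mu>) \<nu>"
    and top: "\<And>z. z \<in> space Z \<Longrightarrow> emeasure (\<mu> z)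
           ((\<phi> -` top_zero_infty_set (\<nu> z) \<inter> space X) - top_zero_infty_set (\<mu> z)) = 0"
  obtains k where "s_finite_kernel (Z \<Otimes>\<^sub>M Y) X k"
    "\<And>z U V. z \<in> space Z \<Longrightarrow> U \<in> sets X \<Longrightarrow> V \<in> sets Y \<Longrightarrow>
       (\<integral>\<^sup>+ y\<in>V. emeasure (k (z, y)) U \<partial>\<nu> z) = emeasure (\<mu> z) (U \<inter> \<phi> -` V)"
proof -
  have X_ne: "space X \<noteq> {}" and Y_ne: "space Y \<noteq> {}" using X Y by (simp_all add: standard_borel_def)
  have mu_k: "kernel Z X \<mu>" and nu_k: "kernel Z Y \<nu>" using mu nu by (simp_all add: s_finite_kernel_def)
  obtain b m where b: "\<And>i. (0::ennreal) < b i" "\<And>i. b i < \<infinity>" and m: "\<And>i. m i \<in> Z \<rightarrow>\<^sub>M subprob_algebra X"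
    and m_le: "\<And>i z. z \<in> space Z \<Longrightarrow> emeasure (m i z) (space X) \<le> ennreal ((1 / 4) ^ Suc i)"
    and mu_sum: "\<And>z A. z \<in> space Z \<Longrightarrow> A \<in> sets X \<Longrightarrow> emeasure (\<mu> z) A = (\<Sum>i. b i * emeasure (m i z) A)"
    by (rule s_finite_kernel_scale[OF X_ne mu]) blast
  obtain c n where c: "\<And>i. (0::ennreal) < c i" "\<And>i. c i < \<infinity>" and n: "\<And>i. n i \<in> Z \<rightarrow>\<^sub>M subprob_algebra Y"
    and n_le: "\<And>i z. z \<in> space Z \<Longrightarrow> emeasure (n i z) (space Y) \<le> ennreal ((1 / 4) ^ Suc i)"
    and nu_sum: "\<And>z A. z \<in> space Z \<Longrightarrow> A \<in> sets Y \<Longrightarrow> emeasure (\<nu> z) A = (\<Sum>i. c i * emeasure (n i z) A)"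
    by (rule s_finite_kernel_scale[OF Y_ne nu]) blast
  define pm where "pm i z = distr (m i z) Y \<phi>" for i z
  have pm: "pm i \<in> Z \<rightarrow>\<^sub>M subprob_algebra Y" for i
    unfolding pm_def by (rule measurable_compose[OF m measurable_distr[OF phi]])
  have pm_eq: "emeasure (pm i z) V = emeasure (m i z) (\<phi> -` V \<inter> space X)" if z: "z \<in> space Z" and V: "V \<in> sets Y" for i z V
  proof -
    have "\<phi> \<in> m i z \<rightarrow>\<^sub>M Y"
      using phi by (simp only: measurable_cong_sets[OF sets_kernel[OF m z] refl])
    then show ?thesis
      using V sets_eq_imp_space_eq[OF sets_kernel[OF m z]] by (simp add: pm_def emeasure_distr)
  qed
  have pm_le: "emeasure (pm i z) (space Y) \<le> ennreal ((1 / 4) ^ Suc i)" if z: "z \<in> space Z" for i z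
  proof -
    have "\<phi> -` space Y \<inter> space X = space X" using measurable_space[OF phi] by auto
    then show ?thesis using m_le[OF z] pm_eq[OF z sets.top] by simp
  qed
  obtain \<rho> where rho: "\<rho> \<in> Z \<rightarrow>\<^sub>M subprob_algebra Y"
    and n_rho: "\<And>i z A. z \<in> space Z \<Longrightarrow> A \<in> sets Y \<Longrightarrow> emeasure (n i z) A \<le> emeasure (\<rho> z) A"
    and pm_rho: "\<And>i z A. z \<in> space Z \<Longrightarrow> A \<in> sets Y \<Longrightarrow> emeasure (pm i z) A \<le> emeasure (\<rho> z) A"
    and rho_0: "\<And>z A. z \<in> space Z \<Longrightarrow> A \<in> sets Y \<Longrightarrow> (\<And>i. emeasure (n i z) A = 0) \<Longrightarrow> (\<And>i. emeasure (pm i z) A = 0) \<Longrightarrow>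
      emeasure (\<rho> z) A = 0"
    by (rule interleaved_kernels_dominating[OF Y_ne n pm n_le pm_le]) blast+
  obtain h where h [measurable]: "h \<in> borel_measurable (Z \<Otimes>\<^sub>M Y)"
    and nu_h: "\<And>z. z \<in> space Z \<Longrightarrow> \<nu> z = density (\<rho> z) (\<lambda>y. h (z, y))"
    by (rule kernel_density_of_dominating[OF Y n rho n_rho nu_k nu_sum]) blast+
  have "\<exists>q. q \<in> Z \<Otimes>\<^sub>M Y \<rightarrow>\<^sub>M subprob_algebra X \<and> (\<forall>z\<in>space Z. \<forall>U\<in>sets X. \<forall>V\<in>sets Y.
       (\<integral>\<^sup>+ y\<in>V. emeasure (q (z, y)) U \<partial>\<rho> z) = emeasure (m i z) (U \<inter> \<phi> -` V))" for i
  proof -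
    have dom: "emeasure (m i z) (\<phi> -` V \<inter> space X) \<le> emeasure (\<rho> z) V" if "z \<in> space Z" "V \<in> sets Y" for z V
      using pm_rho[OF that, of i] by (simp add: pm_eq that)
    show ?thesis
    proof (rule subprob_disintegration[OF X Y m rho phi dom])
      fix p assume "p \<in> Z \<Otimes>\<^sub>M Y \<rightarrow>\<^sub>M subprob_algebra X"
        and "\<And>z U V. z \<in> space Z \<Longrightarrow> U \<in> sets X \<Longrightarrow> V \<in> sets Y \<Longrightarrow>
         (\<integral>\<^sup>+ y\<in>V. emeasure (p (z, y)) U \<partial>\<rho> z) = emeasure (m i z) (U \<inter> \<phi> -` V)"
      then show ?thesis by (intro exI[of _ p] conjI ballI)
    qed
  qed
  then obtain q where q: "\<And>i. q i \<in> Z \<Otimes>\<^sub>M Y \<rightarrow>\<^sub>M subprob_algebra X"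
    and q_int: "\<And>i z U V. z \<in> space Z \<Longrightarrow> U \<in> sets X \<Longrightarrow> V \<in> sets Y \<Longrightarrow>
       (\<integral>\<^sup>+ y\<in>V. emeasure (q i (z, y)) U \<partial>\<rho> z) = emeasure (m i z) (U \<inter> \<phi> -` V)"
    by metis
  \<comment> \<open>The value 1 at infinite \<open>h\<close> is deliberate: the true inverse would
    be 0 and erase the mass over that set. As \<open>w\<close> is finite everywhere, the pieces
    \<open>ki i\<close> stay finite measures.\<close>
  define w where "w p = (if h p = 0 \<or> h p = \<infinity> then 1 else inverse (h p))" for p
  have w [measurable]: "w \<in> borel_measurable (Z \<Otimes>\<^sub>M Y)" unfolding w_def by measurable
  have w_fin: "w p < \<infinity>" for p
    by (cases "h p") (auto simp: w_def inverse_ennreal top_unique)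
  have hw: "h p * w p = (if h p = \<infinity> then \<infinity> else 1)" if "h p \<noteq> 0" for p
    using that by (auto simp: w_def less_top simp flip: divide_ennreal_def)
  define ki where "ki i p = scale_measure (b i * w p) (q i p)" for i p
  define k where "k p = measure_sum X (\<lambda>i. ki i p)" for p
  have ki: "kernel (Z \<Otimes>\<^sub>M Y) X (ki i)" for i
    using sets_kernel[OF q] measurable_emeasure_kernel[OF q] by (auto simp: kernel_def ki_def)
  have k_sum: "emeasure (k p) U = (\<Sum>i. emeasure (ki i p) U)" if "p \<in> space (Z \<Otimes>\<^sub>M Y)" "U \<in> sets X" for p U
    unfolding k_def using ki that by (intro emeasure_measure_sum) (auto simp: kernel_def)
  have k: "kernel (Z \<Otimes>\<^sub>M Y) X k"
    unfolding kernel_def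
  proof (intro conjI ballI)
    show "sets (k p) = sets X" for p by (simp add: k_def)
    fix U assume U: "U \<in> sets X"
    have [measurable]: "(\<lambda>p. emeasure (ki i p) U) \<in> borel_measurable (Z \<Otimes>\<^sub>M Y)" for i
      using ki U by (simp add: kernel_def)
    show "(\<lambda>p. emeasure (k p) U) \<in> borel_measurable (Z \<Otimes>\<^sub>M Y)"
      using U by (subst measurable_cong[OF k_sum]) auto
  qed
  have "s_finite_kernel (Z \<Otimes>\<^sub>M Y) X k"
  proof (rule s_finite_kernelI[OF k ki _ k_sum])
    fix i p assume p: "p \<in> space (Z \<Otimes>\<^sub>M Y)"
    have "emeasure (q i p) (space X) \<le> 1"
      by (rule subprob_space.subprob_emeasure_le_1[OF subprob_space_kernel[OF q p]])
    then have "emeasure (q i p) (space X) < \<infinity>"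
      by (rule le_less_trans) simp
    then show "emeasure (ki i p) (space X) < \<infinity>"
      using b(2)[of i] w_fin[of p] by (simp add: ki_def ennreal_mult_less_top)
  qed
  moreover have "(\<integral>\<^sup>+ y\<in>V. emeasure (k (z, y)) U \<partial>\<nu> z) = emeasure (\<mu> z) (U \<inter> \<phi> -` V)"
    if z: "z \<in> space Z" and U [measurable]: "U \<in> sets X" and V [measurable]: "V \<in> sets Y" for z U V
  proof -
    note sets_rho [measurable_cong, simp] = sets_kernel[OF rho z]
    note space_rho [simp] = sets_eq_imp_space_eq[OF sets_rho]
    have sets_mu [measurable_cong, simp]: "sets (\<mu> z) = sets X" using mu_k z by (simp add: kernel_def)
    have space_mu [simp]: "space (\<mu> z) = space X" by (rule sets_eq_imp_space_eq) simp
    interpret rho: subprob_space "\<rho> z" by (rule subprob_space_kernel[OF rho z])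
    have hz [measurable]: "(\<lambda>y. h (z, y)) \<in> borel_measurable Y" using z by (rule measurable_Pair2[OF h])
    have wz [measurable]: "(\<lambda>y. w (z, y)) \<in> borel_measurable Y" using z by (rule measurable_Pair2[OF w])
    have [measurable]: "(\<lambda>y. emeasure (q i (z, y)) A) \<in> borel_measurable Y" if "A \<in> sets X" for i A
      using measurable_Pair2[OF measurable_emeasure_kernel[OF q that] z] by simp
    have [measurable]: "(\<lambda>y. emeasure (k (z, y)) A) \<in> borel_measurable Y" if "A \<in> sets X" for A
      using measurable_Pair2[OF _ z, of "\<lambda>p. emeasure (k p) A"] k that by (simp add: kernel_def)
    have preim [measurable]: "A \<inter> \<phi> -` B \<in> sets X" if "A \<in> sets X" "B \<in> sets Y" for A B
    proof -
      have "A \<inter> \<phi> -` B = A \<inter> (\<phi> -` B \<inter> space X)" using sets.sets_into_space[OF that(1)] by auto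
      also have "\<dots> \<in> sets X" using that by measurable
      finally show ?thesis .
    qed
    have mu_null: "emeasure (\<mu> z) (\<phi> -` B \<inter> space X) = 0" if "B \<in> sets Y" "emeasure (\<nu> z) B = 0" for B
    proof -
      have "sets (\<nu> z) = sets Y" using nu_k z by (simp add: kernel_def)
      then have "B \<in> null_sets (\<nu> z)" using that by auto
      then have "B \<in> null_sets (distr (\<mu> z) Y \<phi>)"
        using ac z by (auto simp: abs_cont_kernel_def pushforward_kernel_def absolutely_continuous_def)
      then have "emeasure (distr (\<mu> z) Y \<phi>) B = 0" by auto
      then show ?thesis using that(1) by (simp add: emeasure_distr)
    qed
    define T where "T = {y \<in> space Y. h (z, y) = \<infinity>}"
    have [measurable]: "T \<in> sets Y" unfolding T_def by measurable
    \<comment> \<open>\<open>T\<close> need not be the chosen top set, but it exceeds it only by a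
      \<open>\<nu> z\<close>-null set, whose preimage is \<open>\<mu> z\<close>-null by absolute
      continuity. So up to null sets the part of \<open>X\<close> over \<open>T\<close> lies in the
      chosen top set of \<open>\<mu> z\<close>.\<close>
    have zero_infty: "emeasure (\<mu> z) (U \<inter> \<phi> -` (V \<inter> T)) \<in> {0, \<infinity>}"
    proof -
      let ?\<tau> = "top_zero_infty_set (\<nu> z)" and ?\<sigma> = "top_zero_infty_set (\<mu> z)"
      have sets_nu: "sets (\<nu> z) = sets Y" using nu_k z by (simp add: kernel_def)
      have tau: "is_top_zero_infty_set (\<nu> z) ?\<tau>" by (rule s_finite_kernel_top_zero_infty_set[OF Y nu z])
      have sigma: "zero_infty_set (\<mu> z) ?\<sigma>"
        using s_finite_kernel_top_zero_infty_set[OF X mu z] by (simp add: is_top_zero_infty_set_def)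
      have [measurable]: "?\<tau> \<in> sets Y" "?\<sigma> \<in> sets X"
        using tau sigma by (auto simp: is_top_zero_infty_set_def zero_infty_set_def sets_nu)
      have "is_top_zero_infty_set (\<nu> z) T"
        using is_top_zero_infty_set_density[of "\<rho> z" "\<lambda>y. h (z, y)"] by (simp add: nu_h z T_def rho.finite_measure_axioms)
      then have "emeasure (\<nu> z) (T - ?\<tau>) = 0"
        using tau by (simp add: is_top_zero_infty_set_def)
      then have N1: "emeasure (\<mu> z) (\<phi> -` (T - ?\<tau>) \<inter> space X) = 0"
        by (intro mu_null) auto
      note N2 = top[OF z]
      let ?A = "U \<inter> \<phi> -` (V \<inter> T)"
      let ?N = "(\<phi> -` (T - ?\<tau>) \<inter> space X) \<union> ((\<phi> -` ?\<tau> \<inter> space X) - ?\<sigma>)"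
      have N: "?N \<in> null_sets (\<mu> z)"
        using N1 N2 by (intro null_sets.Un null_setsI) auto
      have A: "?A \<in> sets X" by (intro preim) auto
      then have AN: "?A \<inter> ?\<sigma> \<in> sets X" "?A \<inter> ?\<sigma> \<union> ?N \<in> sets X"
        using null_setsD2[OF N] by (auto intro!: sets.Int sets.Un simp del: Un_assoc)
      have "emeasure (\<mu> z) ?A \<le> emeasure (\<mu> z) (?A \<inter> ?\<sigma> \<union> ?N)"
        using sets.sets_into_space[OF U] AN by (intro emeasure_mono) auto
      also have "\<dots> = emeasure (\<mu> z) (?A \<inter> ?\<sigma>)"
        using N AN by (intro emeasure_Un_null_set) auto
      finally have "emeasure (\<mu> z) ?A = emeasure (\<mu> z) (?A \<inter> ?\<sigma>)"
        using A by (intro antisym[OF _ emeasure_mono]) auto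
      moreover have "emeasure (\<mu> z) (?A \<inter> ?\<sigma>) \<in> {0, \<infinity>}"
        using sigma AN(1) unfolding zero_infty_set_def by auto
      ultimately show ?thesis by simp
    qed
    \<comment> \<open>The set where \<open>h\<close> vanishes is \<open>\<nu> z\<close>-null, hence
      null for all \<open>n i\<close> and, by absolute continuity, for all \<open>pm i\<close>;
      these determine the null sets of \<open>\<rho> z\<close>.\<close>
    have h_pos: "AE y in \<rho> z. h (z, y) \<noteq> 0"
    proof -
      define B where "B = {y \<in> space Y. h (z, y) = 0}"
      have [measurable]: "B \<in> sets Y" unfolding B_def by measurable
      have "emeasure (\<nu> z) B = (\<integral>\<^sup>+ y\<in>B. h (z, y) \<partial>\<rho> z)"
        by (simp add: nu_h z emeasure_density)
      also have "\<dots> = (\<integral>\<^sup>+ y. 0 \<partial>\<rho> z)"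
        by (intro nn_integral_cong) (auto simp: B_def split: split_indicator)
      finally have nu_B: "emeasure (\<nu> z) B = 0" by simp
      then have "(\<Sum>i. c i * emeasure (n i z) B) = 0" by (simp add: nu_sum z)
      then have "emeasure (n i z) B = 0" for i
        using c(1) by (simp add: suminf_eq_zero_iff less_imp_neq[symmetric])
      moreover have "emeasure (pm i z) B = 0" for i
      proof -
        have "(\<Sum>i. b i * emeasure (m i z) (\<phi> -` B \<inter> space X)) = 0"
          using mu_null[OF _ nu_B] by (simp add: mu_sum z)
        then show ?thesis using b(1) by (simp add: pm_eq z suminf_eq_zero_iff less_imp_neq[symmetric])
      qed
      ultimately have "emeasure (\<rho> z) B = 0" by (intro rho_0[OF z]) auto
      then show ?thesis by (intro AE_I[of _ _ B]) (auto simp: B_def)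
    qed
    \<comment> \<open>The factor \<open>h * w\<close> is 1 off \<open>T\<close> and infinite on
      \<open>T\<close>, that is, 1 plus infinity times the indicator of \<open>T\<close>. In this
      additive form the integral splits into the desired value and a term over \<open>T\<close> that
      it absorbs.\<close>
    have pointwise: "AE y in \<rho> z. h (z, y) * (emeasure (k (z, y)) U * indicator V y) =
        (\<Sum>i. b i * (emeasure (q i (z, y)) U * indicator V y) +
          \<infinity> * (b i * (emeasure (q i (z, y)) U * indicator (V \<inter> T) y)))"
      using h_pos AE_space[of "\<rho> z"]
    proof eventually_elim
      case (elim y)
      then have y: "(z, y) \<in> space (Z \<Otimes>\<^sub>M Y)" using z by (simp add: space_pair_measure)
      have "h (z, y) * (emeasure (k (z, y)) U * indicator V y) =
          (\<Sum>i. (h (z, y) * indicator V y) * (b i * w (z, y) * emeasure (q i (z, y)) U))"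
        by (subst ennreal_suminf_cmult) (simp add: k_sum[OF y U] ki_def mult_ac)
      also have "\<dots> = (\<Sum>i. (h (z, y) * w (z, y)) * (b i * (emeasure (q i (z, y)) U * indicator V y)))"
        by (simp add: mult_ac)
      also have "\<dots> = (\<Sum>i. b i * (emeasure (q i (z, y)) U * indicator V y) +
        \<infinity> * (b i * (emeasure (q i (z, y)) U * indicator (V \<inter> T) y)))"
        using elim unfolding hw[OF elim(1)]
        by (intro suminf_cong) (auto simp: T_def ennreal_top_mult split: split_indicator)
      finally show ?case .
    qed
    have "(\<integral>\<^sup>+ y\<in>V. emeasure (k (z, y)) U \<partial>\<nu> z) = (\<integral>\<^sup>+ y. h (z, y) * (emeasure (k (z, y)) U * indicator V y) \<partial>\<rho> z)"
      unfolding nu_h[OF z] by (subst nn_integral_density) auto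
    also have "\<dots> = (\<integral>\<^sup>+ y. (\<Sum>i. b i * (emeasure (q i (z, y)) U * indicator V y) +
        \<infinity> * (b i * (emeasure (q i (z, y)) U * indicator (V \<inter> T) y))) \<partial>\<rho> z)"
      by (rule nn_integral_cong_AE[OF pointwise])
    also have "\<dots> = (\<Sum>i. b i * (\<integral>\<^sup>+ y\<in>V. emeasure (q i (z, y)) U \<partial>\<rho> z) +
        \<infinity> * (b i * (\<integral>\<^sup>+ y\<in>V \<inter> T. emeasure (q i (z, y)) U \<partial>\<rho> z)))"
      by (simp add: nn_integral_suminf nn_integral_add nn_integral_cmult)
    also have "\<dots> = (\<Sum>i. b i * emeasure (m i z) (U \<inter> \<phi> -` V)) + \<infinity> * (\<Sum>i. b i * emeasure (m i z) (U \<inter> \<phi> -` (V \<inter> T)))"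
      by (simp add: q_int[OF z U] suminf_add[symmetric])
    also have "\<dots> = emeasure (\<mu> z) (U \<inter> \<phi> -` V) + \<infinity> * emeasure (\<mu> z) (U \<inter> \<phi> -` (V \<inter> T))"
      by (subst (1 2) mu_sum[OF z preim[OF U]]) auto
    also have "\<dots> = emeasure (\<mu> z) (U \<inter> \<phi> -` V)"
    proof (cases "emeasure (\<mu> z) (U \<inter> \<phi> -` (V \<inter> T)) = 0")
      case False
      then have "emeasure (\<mu> z) (U \<inter> \<phi> -` (V \<inter> T)) = \<infinity>" using zero_infty by simp
      moreover have "emeasure (\<mu> z) (U \<inter> \<phi> -` (V \<inter> T)) \<le> emeasure (\<mu> z) (U \<inter> \<phi> -` V)"
        by (intro emeasure_mono) auto
      ultimately show ?thesis by (simp add: top_unique)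
    qed simp
    finally show ?thesis .
  qed
  ultimately show thesis by (rule that)
qed

text \<open>The identity indexed by \<open>U\<close> and \<open>V\<close> contains both clauses:
  \<open>V = space Y\<close> gives the integral formula, and taking for \<open>U\<close> the
  complement of the preimage of \<open>V\<close> gives the vanishing integrals behind concentration
  on fibres.\<close>

lemma disintegrationI:
  assumes Y: "standard_borel Y" and phi [measurable]: "\<phi> \<in> X \<rightarrow>\<^sub>M Y"
    and nu: "\<And>z. z \<in> space Z \<Longrightarrow> sets (\<nu> z) = sets Y"
    and k: "kernel (Z \<Otimes>\<^sub>M Y) X k"
    and int: "\<And>z U V. z \<in> space Z \<Longrightarrow> U \<in> sets X \<Longrightarrow> V \<in> sets Y \<Longrightarrow>
       (\<integral>\<^sup>+ y\<in>V. emeasure (k (z, y)) U \<partial>\<nu> z) = emeasure (\<mu> z) (U \<inter> \<phi> -` V)"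
  shows "disintegration Z X Y \<mu> \<phi> \<nu> k"
  unfolding disintegration_def
proof (intro conjI ballI)
  fix z U assume z: "z \<in> space Z" and U: "U \<in> sets X"
  have "(\<integral>\<^sup>+ y. emeasure (k (z, y)) U \<partial>\<nu> z) = (\<integral>\<^sup>+ y\<in>space Y. emeasure (k (z, y)) U \<partial>\<nu> z)"
    using sets_eq_imp_space_eq[OF nu[OF z]] by (intro nn_integral_cong) auto
  also have "U \<inter> \<phi> -` space Y = U"
    using sets.sets_into_space[OF U] measurable_space[OF phi] by auto
  then have "(\<integral>\<^sup>+ y\<in>space Y. emeasure (k (z, y)) U \<partial>\<nu> z) = emeasure (\<mu> z) U"
    using int[OF z U sets.top] by simp
  finally show "(\<integral>\<^sup>+ y. emeasure (k (z, y)) U \<partial>\<nu> z) = emeasure (\<mu> z) U" .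
next
  fix z assume z: "z \<in> space Z"
  show "AE y in \<nu> z. emeasure (k (z, y)) (space X - \<phi> -` {y}) = 0"
  proof (rule AE_fibre_null[OF Y phi nu[OF z]])
    show "kernel Y X (\<lambda>y. k (z, y))"
      using k z measurable_Pair2[OF _ z, of "\<lambda>p. emeasure (k p) _"] by (auto simp: kernel_def space_pair_measure)
    fix V assume V: "V \<in> sets Y"
    have "space X - \<phi> -` V = space X - (\<phi> -` V \<inter> space X)" by auto
    also have "\<dots> \<in> sets X" using V by measurable
    finally show "(\<integral>\<^sup>+ y\<in>V. emeasure (k (z, y)) (space X - \<phi> -` V) \<partial>\<nu> z) = 0"
      using int[OF z _ V, of "space X - \<phi> -` V"] by (simp add: Int_commute Diff_Int_distrib)
  qed
qed (rule k)

section \<open>Probability kernels in the sigma-finite case\<close>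

text \<open>Mutual singularity provides sets \<open>C i\<close> such that \<open>ki i\<close>
  charges nothing of \<open>B\<close> outside \<open>C i\<close> and the other summands charge
  nothing of \<open>B\<close> inside it. On the part of \<open>B\<close> in \<open>C i\<close> the
  kernel therefore agrees with a finite measure, which cannot take the value infinity.\<close>

lemma sigma_finite_kernel_zero_infty_set_null:
  assumes k: "sigma_finite_kernel Z X k" and z: "z \<in> space Z" and B: "zero_infty_set (k z) B"
  shows "emeasure (k z) B = 0"
proof -
  obtain ki where ki: "\<And>i. finite_kernel Z X (ki i)"
    and sums: "\<And>U. U \<in> sets X \<Longrightarrow> emeasure (k z) U = (\<Sum>i. emeasure (ki i z) U)"
    and sing: "\<And>i j. i \<noteq> j \<Longrightarrow> mutually_singular_kernels Z X (ki i) (ki j)"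
    using k z unfolding sigma_finite_kernel_def kernel_sums_def by blast
  have sets_k: "sets (k z) = sets X" and sets_ki: "\<And>i. sets (ki i z) = sets X"
    using k ki z by (auto simp: sigma_finite_kernel_def finite_kernel_def kernel_def)
  have B' [measurable]: "B \<in> sets X" using B by (simp add: zero_infty_set_def sets_k)
  have "\<exists>A. A \<in> sets X \<and> emeasure (ki i z) (space X - A) = 0 \<and> emeasure (ki j z) A = 0" if ne: "i \<noteq> j" for i j
  proof -
    obtain A where A: "A \<in> sets (Z \<Otimes>\<^sub>M X)" "emeasure (ki i z) (space X - Pair z -` A) = 0" "emeasure (ki j z) (Pair z -` A) = 0"
      using sing[OF ne] z unfolding mutually_singular_kernels_def vimage_def by blast
    then show ?thesis using sets_Pair1[OF A(1), of z] by blast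
  qed
  then obtain A where A: "\<And>i j. i \<noteq> j \<Longrightarrow> A i j \<in> sets X"
    "\<And>i j. i \<noteq> j \<Longrightarrow> emeasure (ki i z) (space X - A i j) = 0" "\<And>i j. i \<noteq> j \<Longrightarrow> emeasure (ki j z) (A i j) = 0"
    by metis
  define C where "C i = {x \<in> space X. \<forall>j. j \<noteq> i \<longrightarrow> x \<in> A i j}" for i :: nat
  have C [measurable]: "C i \<in> sets X" for i
  proof -
    have "C i = space X - (\<Union>j\<in>{j. j \<noteq> i}. space X - A i j)" by (auto simp: C_def)
    also have "\<dots> \<in> sets X"
      by (intro sets.Diff sets.top sets.countable_UN'') (auto intro: A(1))
    finally show ?thesis .
  qed
  have outside: "emeasure (ki i z) (B - C i) = 0" for i
  proof -
    have "(\<Union>j\<in>{j. j \<noteq> i}. space X - A i j) \<in> null_sets (ki i z)"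
      using A by (intro null_sets_UN' null_setsI) (auto simp: sets_ki)
    moreover have "B - C i \<subseteq> (\<Union>j\<in>{j. j \<noteq> i}. space X - A i j)"
      using sets.sets_into_space[OF B'] by (auto simp: C_def)
    ultimately show ?thesis
      by (metis emeasure_mono null_setsD1 null_setsD2 le_zero_eq)
  qed
  have inside: "emeasure (ki j z) (B \<inter> C i) = 0" if "j \<noteq> i" for i j
  proof -
    have "emeasure (ki j z) (B \<inter> C i) \<le> emeasure (ki j z) (A i j)"
      using A(1) that by (intro emeasure_mono) (auto simp: C_def sets_ki)
    then show ?thesis using A(3)[of i j] that by simp
  qed
  have "emeasure (ki i z) B = 0" for i
  proof -
    have "emeasure (k z) (B \<inter> C i) = emeasure (ki i z) (B \<inter> C i)"
      using sums[of "B \<inter> C i"] inside[of _ i] suminf_finite[of "{i}" "\<lambda>j. emeasure (ki j z) (B \<inter> C i)"] by simp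
    moreover have "emeasure (ki i z) (B \<inter> C i) \<le> (SUP x\<in>space Z. emeasure (ki i x) (space X))"
      using z sets_eq_imp_space_eq[OF sets_ki[of i]] by (intro SUP_upper2[OF z]) (metis emeasure_space)
    then have "emeasure (ki i z) (B \<inter> C i) < \<infinity>"
      using ki[of i] by (auto simp: finite_kernel_def intro: le_less_trans)
    moreover have "emeasure (k z) (B \<inter> C i) \<in> {0, \<infinity>}"
      using B unfolding zero_infty_set_def by (simp add: sets_k)
    ultimately have "emeasure (ki i z) (B \<inter> C i) = 0" by auto
    moreover have "emeasure (ki i z) B = emeasure (ki i z) (B \<inter> C i) + emeasure (ki i z) (B - C i)"
      by (subst plus_emeasure) (auto simp: sets_ki intro!: arg_cong[where f = "emeasure _"])
    ultimately show ?thesis using outside by simp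
  qed
  then show ?thesis using sums[OF B'] by simp
qed

lemma prob_disintegration:
  assumes X: "standard_borel X" and Y: "standard_borel Y"
    and mu: "s_finite_kernel Z X \<mu>" and nu: "s_finite_kernel Z Y \<nu>"
    and phi [measurable]: "\<phi> \<in> X \<rightarrow>\<^sub>M Y"
    and top: "\<And>z. z \<in> space Z \<Longrightarrow> emeasure (\<mu> z)
           ((\<phi> -` top_zero_infty_set (\<nu> z) \<inter> space X) - top_zero_infty_set (\<mu> z)) = 0"
    and k: "kernel (Z \<Otimes>\<^sub>M Y) X k"
    and int: "\<And>z U V. z \<in> space Z \<Longrightarrow> U \<in> sets X \<Longrightarrow> V \<in> sets Y \<Longrightarrow>
       (\<integral>\<^sup>+ y\<in>V. emeasure (k (z, y)) U \<partial>\<nu> z) = emeasure (\<mu> z) (U \<inter> \<phi> -` V)"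
    and sigma: "sigma_finite_kernel Z X \<mu>" and push: "\<And>z. z \<in> space Z \<Longrightarrow> pushforward_kernel Y \<phi> \<mu> z = \<nu> z"
  obtains k' where "prob_kernel (Z \<Otimes>\<^sub>M Y) X k'" "s_finite_kernel (Z \<Otimes>\<^sub>M Y) X k'"
    "disintegration Z X Y \<mu> \<phi> \<nu> k'"
proof -
  obtain x0 where x0: "x0 \<in> space X" using X by (auto simp: standard_borel_def)
  \<comment> \<open>The points with wrong total mass form a measurable set of pairs, so replacing
    the measure there by one fixed point mass keeps joint measurability.\<close>
  define k' where "k' p = (if emeasure (k p) (space X) = 1 then k p else return X x0)" for p
  have sets_k: "sets (k p) = sets X" if "p \<in> space (Z \<Otimes>\<^sub>M Y)" for p using k that by (simp add: kernel_def)
  have k_meas [measurable]: "(\<lambda>p. emeasure (k p) U) \<in> borel_measurable (Z \<Otimes>\<^sub>M Y)" if "U \<in> sets X" for U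
    using k that by (simp add: kernel_def)
  have k': "kernel (Z \<Otimes>\<^sub>M Y) X k'"
    unfolding kernel_def
  proof (intro conjI ballI)
    show "sets (k' p) = sets X" if "p \<in> space (Z \<Otimes>\<^sub>M Y)" for p using sets_k[OF that] by (simp add: k'_def)
    fix U assume [measurable]: "U \<in> sets X"
    have "(\<lambda>p. emeasure (k' p) U) = (\<lambda>p. if emeasure (k p) (space X) = 1 then emeasure (k p) U else indicator U x0)"
      by (auto simp: k'_def)
    also have "\<dots> \<in> borel_measurable (Z \<Otimes>\<^sub>M Y)" by measurable
    finally show "(\<lambda>p. emeasure (k' p) U) \<in> borel_measurable (Z \<Otimes>\<^sub>M Y)" .
  qed
  have one: "emeasure (k' p) (space X) = 1" for p using x0 by (simp add: k'_def)
  have prob: "prob_kernel (Z \<Otimes>\<^sub>M Y) X k'" using k' one by (simp add: prob_kernel_def)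
  have "(SUP p\<in>space (Z \<Otimes>\<^sub>M Y). emeasure (k' p) (space X)) \<le> 1"
    by (rule SUP_least) (simp add: one)
  then have "finite_kernel (Z \<Otimes>\<^sub>M Y) X k'"
    using k' by (auto simp: finite_kernel_def intro: le_less_trans)
  then have s_fin: "s_finite_kernel (Z \<Otimes>\<^sub>M Y) X k'" by (rule finite_kernel_imp_s_finite)
  have sets_nu: "sets (\<nu> z) = sets Y" if "z \<in> space Z" for z using nu that by (simp add: s_finite_kernel_def kernel_def)
  have AE: "AE y in \<nu> z. k' (z, y) = k (z, y)" if z: "z \<in> space Z" for z
  proof -
    note [measurable_cong, simp] = sets_nu[OF z]
    have [measurable_cong, simp]: "sets (\<mu> z) = sets X" using mu z by (simp add: s_finite_kernel_def kernel_def)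
    have space_mu [simp]: "space (\<mu> z) = space X" by (rule sets_eq_imp_space_eq) simp
    have nu_eq: "emeasure (\<nu> z) V = emeasure (\<mu> z) (\<phi> -` V \<inter> space X)" if "V \<in> sets Y" for V
      using that push[OF z, symmetric] by (simp add: pushforward_kernel_def emeasure_distr)
    let ?\<tau> = "top_zero_infty_set (\<nu> z)" and ?\<sigma> = "top_zero_infty_set (\<mu> z)"
    have tau: "is_top_zero_infty_set (\<nu> z) ?\<tau>" by (rule s_finite_kernel_top_zero_infty_set[OF Y nu z])
    have sigma_top: "zero_infty_set (\<mu> z) ?\<sigma>"
      using s_finite_kernel_top_zero_infty_set[OF X mu z] by (simp add: is_top_zero_infty_set_def)
    have [measurable]: "?\<tau> \<in> sets Y" "?\<sigma> \<in> sets X"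
      using tau sigma_top by (auto simp: is_top_zero_infty_set_def zero_infty_set_def)
    \<comment> \<open>A pushforward of a sigma-finite measure can fail to be sigma-finite. The
      condition on top sets excludes this: the preimage of \<open>?\<tau>\<close> lies up to a null
      set in \<open>?\<sigma>\<close>, which is null.\<close>
    have "emeasure (\<nu> z) ?\<tau> \<le> emeasure (\<mu> z) ((\<phi> -` ?\<tau> \<inter> space X - ?\<sigma>) \<union> ?\<sigma>)"
      unfolding nu_eq[OF \<open>?\<tau> \<in> sets Y\<close>] by (intro emeasure_mono) auto
    also have "\<dots> \<le> emeasure (\<mu> z) (\<phi> -` ?\<tau> \<inter> space X - ?\<sigma>) + emeasure (\<mu> z) ?\<sigma>"
      by (intro emeasure_subadditive) auto
    also have "\<dots> = 0"
      using top[OF z] sigma_finite_kernel_zero_infty_set_null[OF sigma z sigma_top] by simp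
    finally have tau_null: "emeasure (\<nu> z) ?\<tau> = 0" by simp
    have "sigma_finite_measure (\<nu> z)"
    proof (rule s_finite_kernel_imp_sigma_finite_measure[OF Y nu z])
      fix B assume B: "zero_infty_set (\<nu> z) B"
      then have [measurable]: "B \<in> sets Y" by (simp add: zero_infty_set_def)
      have "emeasure (\<nu> z) B \<le> emeasure (\<nu> z) ((B - ?\<tau>) \<union> ?\<tau>)"
        by (intro emeasure_mono) auto
      also have "\<dots> \<le> emeasure (\<nu> z) (B - ?\<tau>) + emeasure (\<nu> z) ?\<tau>"
        by (intro emeasure_subadditive) auto
      finally show "emeasure (\<nu> z) B = 0"
        using tau B tau_null by (simp add: is_top_zero_infty_set_def)
    qed
    then interpret sigma_finite_measure "\<nu> z" .
    have kz [measurable]: "(\<lambda>y. emeasure (k (z, y)) (space X)) \<in> borel_measurable Y"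
      using z by (intro measurable_Pair2[OF k_meas]) auto
    \<comment> \<open>The fibre mass and the constant 1 are both densities of \<open>\<nu> z\<close>
      with respect to itself; sigma-finiteness makes densities unique almost everywhere.\<close>
    have "density (\<nu> z) (\<lambda>y. emeasure (k (z, y)) (space X)) = density (\<nu> z) (\<lambda>_. 1)"
    proof (rule measure_eqI)
      fix V assume "V \<in> sets (density (\<nu> z) (\<lambda>y. emeasure (k (z, y)) (space X)))"
      then have V: "V \<in> sets Y" by simp
      then show "emeasure (density (\<nu> z) (\<lambda>y. emeasure (k (z, y)) (space X))) V = emeasure (density (\<nu> z) (\<lambda>_. 1)) V"
        using int[OF z sets.top V] nu_eq[OF V] by (simp add: emeasure_density density_1 Int_commute)
    qed simp
    then have "AE y in \<nu> z. emeasure (k (z, y)) (space X) = 1"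
      by (subst (asm) density_unique_iff) auto
    then show ?thesis by eventually_elim (simp add: k'_def)
  qed
  have "disintegration Z X Y \<mu> \<phi> \<nu> k'"
  proof (rule disintegrationI[OF Y phi sets_nu k'])
    fix z U V assume z: "z \<in> space Z" and UV: "U \<in> sets X" "V \<in> sets Y"
    have "(\<integral>\<^sup>+ y\<in>V. emeasure (k' (z, y)) U \<partial>\<nu> z) = (\<integral>\<^sup>+ y\<in>V. emeasure (k (z, y)) U \<partial>\<nu> z)"
      using AE[OF z] by (intro nn_integral_cong_AE) (auto elim!: eventually_mono)
    then show "(\<integral>\<^sup>+ y\<in>V. emeasure (k' (z, y)) U \<partial>\<nu> z) = emeasure (\<mu> z) (U \<inter> \<phi> -` V)"
      using int[OF z UV] by simp
  qed
  with prob s_fin show thesis by (rule that)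
qed

section \<open>The counterexample\<close>

lemma standard_borel_real: "standard_borel (borel :: real measure)"
  unfolding standard_borel_def
proof (intro conjI exI)
  show "Metric_space (space borel) (dist :: real \<Rightarrow> real \<Rightarrow> real)" by (simp add: Met_TC.Metric_space_axioms)
  show "Metric_space.mcomplete (space borel) (dist :: real \<Rightarrow> real \<Rightarrow> real)"
    using complete_UNIV by (simp add: mcomplete_iff_complete)
  show "separable_space (Metric_space.mtopology (space borel) (dist :: real \<Rightarrow> real \<Rightarrow> real))"
    unfolding separable_space_def using countable_rat Rats_closure_real by auto
  show "sets borel = sigma_sets (space borel) {U. openin (Metric_space.mtopology (space borel) (dist :: real \<Rightarrow> real \<Rightarrow> real)) U}"
    by (simp add: borel_def)
qed simp

lemma constant_s_finite_kernel:
  assumes m: "\<And>i. sets (m i) = sets Y" "\<And>i. emeasure (m i) (space Y) < \<infinity>"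
  shows "s_finite_kernel Z Y (\<lambda>_. measure_sum Y m)"
  using m by (intro s_finite_kernelI[where ki = "\<lambda>i _. m i"]) (auto simp: kernel_def emeasure_measure_sum)

text \<open>Counting measure on the naturals and \<open>\<infinity>\<close> times a point mass on a one-point base: every
  value of \<open>\<integral>\<nu>(dy) k(y, U)\<close> is \<open>0\<close> or \<open>\<infinity>\<close>, whereas a point has mass \<open>1\<close>.\<close>

lemma no_disintegration_example:
  shows "\<exists>(X :: real measure) (Y :: real measure) (Z :: real measure) \<mu> \<nu> \<phi>.
        standard_borel X \<and> standard_borel Y \<and>
        s_finite_kernel Z X \<mu> \<and> s_finite_kernel Z Y \<nu> \<and>
        \<phi> \<in> X \<rightarrow>\<^sub>M Y \<and>
        infty_abs_cont_kernel Z (pushforward_kernel Y \<phi> \<mu>) \<nu> \<and>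
        \<not> (\<exists>k. disintegration Z X Y \<mu> \<phi> \<nu> k)"
proof -
  define M :: "real measure" where "M = measure_sum borel (\<lambda>i. return borel (real i))"
  define N :: "real measure" where "N = measure_sum borel (\<lambda>i. return borel 0)"
  have sets_MN [measurable_cong, simp]: "sets M = sets borel" "sets N = sets borel" by (simp_all add: M_def N_def)
  have space_MN [simp]: "space M = UNIV" "space N = UNIV" by (simp_all add: M_def N_def)
  have M: "emeasure M A = (\<Sum>i. indicator A (real i))" if "A \<in> sets borel" for A
    unfolding M_def using that by (subst emeasure_measure_sum) auto
  have inf_sum: "(\<Sum>i::nat. c) = \<infinity> * c" for c :: ennreal
  proof -
    have "(\<Sum>i::nat. c) = (\<integral>\<^sup>+ i. c \<partial>count_space (UNIV :: nat set))"
      by (rule nn_integral_count_space_nat[symmetric])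
    then show ?thesis by (simp add: nn_integral_const mult.commute)
  qed
  have N: "emeasure N A = \<infinity> * indicator A 0" if "A \<in> sets borel" for A
    unfolding N_def using that by (subst emeasure_measure_sum) (auto simp: inf_sum)
  have "N = scale_measure \<infinity> (return borel 0)"
    by (rule measure_eqI) (auto simp: N)
  then have int_N: "(\<integral>\<^sup>+ y. f y \<partial>N) = \<infinity> * f 0" if "f \<in> borel_measurable borel" for f
    using that by (simp add: nn_integral_scale_measure nn_integral_return)
  \<comment> \<open>The image of counting measure is \<open>N\<close> itself, so the required
    relation between the two kernels holds by reflexivity.\<close>
  have "distr M borel (\<lambda>_. 0) = N"
  proof (rule measure_eqI)
    fix A :: "real set" assume "A \<in> sets (distr M borel (\<lambda>_. 0))"
    then have A: "A \<in> sets borel" by simp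
    have "emeasure (distr M borel (\<lambda>_. 0)) A = (\<Sum>i. indicator ((\<lambda>_. 0) -` A) (real i))"
      using A by (subst emeasure_distr) (auto simp: M)
    also have "\<dots> = emeasure N A"
      using A by (simp add: N inf_sum indicator_vimage)
    finally show "emeasure (distr M borel (\<lambda>_. 0)) A = emeasure N A" .
  qed simp
  then have push: "pushforward_kernel borel (\<lambda>_. 0) (\<lambda>_. M) = (\<lambda>_. N)"
    by (simp add: pushforward_kernel_def)
  have no: "\<not> disintegration borel borel borel (\<lambda>_. M) (\<lambda>_. 0) (\<lambda>_. N) k" for k :: "real \<times> real \<Rightarrow> real measure"
  proof
    assume "disintegration borel borel borel (\<lambda>_. M) (\<lambda>_. 0) (\<lambda>_. N) k"
    then have k: "kernel (borel \<Otimes>\<^sub>M borel) borel k" and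
      int: "(\<integral>\<^sup>+ y. emeasure (k (0, y)) {0} \<partial>N) = emeasure M {0}"
      by (auto simp: disintegration_def)
    have "(\<lambda>y. emeasure (k (0, y)) {0}) \<in> borel_measurable borel"
      using k by (intro measurable_Pair2[of "\<lambda>p. emeasure (k p) {0}" borel]) (auto simp: kernel_def)
    then have "\<infinity> * emeasure (k (0, 0)) {0} = emeasure M {0}"
      using int int_N by simp
    moreover have "emeasure M {0} = 1"
      using suminf_finite[of "{0}" "\<lambda>i. indicator {0} (real i) :: ennreal"] by (simp add: M)
    ultimately show False by (cases "emeasure (k (0, 0)) {0} = 0") (auto simp: ennreal_top_mult)
  qed
  show ?thesis
  proof (intro exI conjI)
    show "s_finite_kernel borel borel (\<lambda>_::real. M)" "s_finite_kernel borel borel (\<lambda>_::real. N)"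
      unfolding M_def N_def by (rule constant_s_finite_kernel; simp)+
    show "infty_abs_cont_kernel borel (pushforward_kernel borel (\<lambda>_. 0) (\<lambda>_::real. M)) (\<lambda>_. N)"
      unfolding push by (simp add: infty_abs_cont_kernel_def abs_cont_kernel_def absolutely_continuous_def)
    show "\<not> (\<exists>k. disintegration borel borel borel (\<lambda>_::real. M) (\<lambda>_. 0) (\<lambda>_. N) k)" using no by blast
  qed (simp_all add: standard_borel_real)
qed

theorem theorem13:
  shows
    "(\<forall>(X :: 'a measure) (Y :: 'b measure) (Z :: 'c measure) \<mu> \<nu> \<phi>.
        standard_borel X \<and> standard_borel Y \<and>
        s_finite_kernel Z X \<mu> \<and> s_finite_kernel Z Y \<nu> \<and>
        \<phi> \<in> X \<rightarrow>\<^sub>M Y \<and>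
        abs_cont_kernel Z (pushforward_kernel Y \<phi> \<mu>) \<nu> \<and>
        (\<forall>z\<in>space Z. emeasure (\<mu> z)
           ((\<phi> -` top_zero_infty_set (\<nu> z) \<inter> space X) - top_zero_infty_set (\<mu> z)) = 0)
        \<longrightarrow>
        (\<exists>k. s_finite_kernel (Z \<Otimes>\<^sub>M Y) X k \<and> disintegration Z X Y \<mu> \<phi> \<nu> k) \<and>
        (sigma_finite_kernel Z X \<mu> \<and>
         (\<forall>z\<in>space Z. pushforward_kernel Y \<phi> \<mu> z = \<nu> z)
         \<longrightarrow>
         (\<exists>k. s_finite_kernel (Z \<Otimes>\<^sub>M Y) X k \<and> prob_kernel (Z \<Otimes>\<^sub>M Y) X k \<and>
              disintegration Z X Y \<mu> \<phi> \<nu> k)))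
     \<and>
     (\<exists>(X :: real measure) (Y :: real measure) (Z :: real measure) \<mu> \<nu> \<phi>.
        standard_borel X \<and> standard_borel Y \<and>
        s_finite_kernel Z X \<mu> \<and> s_finite_kernel Z Y \<nu> \<and>
        \<phi> \<in> X \<rightarrow>\<^sub>M Y \<and>
        infty_abs_cont_kernel Z (pushforward_kernel Y \<phi> \<mu>) \<nu> \<and>
        \<not> (\<exists>k. disintegration Z X Y \<mu> \<phi> \<nu> k))"
proof (rule conjI[OF _ no_disintegration_example], intro allI impI)
  fix X :: "'a measure" and Y :: "'b measure" and Z :: "'c measure" and \<mu> \<nu> \<phi>
  assume asm: "standard_borel X \<and> standard_borel Y \<and>
        s_finite_kernel Z X \<mu> \<and> s_finite_kernel Z Y \<nu> \<and>
        \<phi> \<in> X \<rightarrow>\<^sub>M Y \<and>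
        abs_cont_kernel Z (pushforward_kernel Y \<phi> \<mu>) \<nu> \<and>
        (\<forall>z\<in>space Z. emeasure (\<mu> z)
           ((\<phi> -` top_zero_infty_set (\<nu> z) \<inter> space X) - top_zero_infty_set (\<mu> z)) = 0)"
  then have X: "standard_borel X" and Y: "standard_borel Y"
    and mu: "s_finite_kernel Z X \<mu>" and nu: "s_finite_kernel Z Y \<nu>" and phi: "\<phi> \<in> X \<rightarrow>\<^sub>M Y"
    and ac: "abs_cont_kernel Z (pushforward_kernel Y \<phi> \<mu>) \<nu>"
    and top: "\<And>z. z \<in> space Z \<Longrightarrow> emeasure (\<mu> z)
           ((\<phi> -` top_zero_infty_set (\<nu> z) \<inter> space X) - top_zero_infty_set (\<mu> z)) = 0"
    by simp_all
  show "(\<exists>k. s_finite_kernel (Z \<Otimes>\<^sub>M Y) X k \<and> disintegration Z X Y \<mu> \<phi> \<nu> k) \<and>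
        (sigma_finite_kernel Z X \<mu> \<and> (\<forall>z\<in>space Z. pushforward_kernel Y \<phi> \<mu> z = \<nu> z) \<longrightarrow>
         (\<exists>k. s_finite_kernel (Z \<Otimes>\<^sub>M Y) X k \<and> prob_kernel (Z \<Otimes>\<^sub>M Y) X k \<and> disintegration Z X Y \<mu> \<phi> \<nu> k))"
  proof (rule s_finite_disintegration[OF X Y mu nu phi ac top])
    fix k assume k: "s_finite_kernel (Z \<Otimes>\<^sub>M Y) X k"
      and int: "\<And>z U V. z \<in> space Z \<Longrightarrow> U \<in> sets X \<Longrightarrow> V \<in> sets Y \<Longrightarrow>
        (\<integral>\<^sup>+ y\<in>V. emeasure (k (z, y)) U \<partial>\<nu> z) = emeasure (\<mu> z) (U \<inter> \<phi> -` V)"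
    have kernel: "kernel (Z \<Otimes>\<^sub>M Y) X k" using k by (simp add: s_finite_kernel_def)
    have "\<And>z. z \<in> space Z \<Longrightarrow> sets (\<nu> z) = sets Y" using nu by (simp add: s_finite_kernel_def kernel_def)
    then have "disintegration Z X Y \<mu> \<phi> \<nu> k"
      using Y phi kernel int by (intro disintegrationI)
    moreover have "\<exists>k. s_finite_kernel (Z \<Otimes>\<^sub>M Y) X k \<and> prob_kernel (Z \<Otimes>\<^sub>M Y) X k \<and> disintegration Z X Y \<mu> \<phi> \<nu> k"
      if "sigma_finite_kernel Z X \<mu>" "\<And>z. z \<in> space Z \<Longrightarrow> pushforward_kernel Y \<phi> \<mu> z = \<nu> z"
      by (rule prob_disintegration[OF X Y mu nu phi top kernel int that]) blast+
    ultimately show ?thesis using k by blast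
  qed
qed

end
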